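(* Let $\mathbb S^1$ be the unit circle with its geodesic distance $\mathsf d_{\mathbb S^1}$, and let the flat torus $\mathbb S^1\times\mathbb S^1$ be equipped with the locally Euclidean (flat) metric $\mathsf d((x_1,x_2),(y_1,y_2))=\sqrt{\mathsf d_{\mathbb S^1}^2(x_1,y_1)+\mathsf d_{\mathbb S^1}^2(x_2,y_2)}$ and the normalized volume measure. Then the infinite MDS map $M\colon\mathbb S^1\times\mathbb S^1\to\ell^2$ satisfies \[ \|M((x_1,x_2))-M((y_1,y_2))\|_2^2=\pi\left(\mathsf d_{\mathbb S^1}(x_1,y_1)+\mathsf d_{\mathbb S^1}(x_2,y_2)\right) \] for all $(x_1,x_2),(y_1,y_2)\in\mathbb S^1\times\mathbb S^1$, i.e. it provides a bi-H\"older embedding of the flat torus in a Hilbert space.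
   Context: For a complete separable metric space $(X,\mathsf d)$ with a Borel probability measure $\mu$ of finite fourth moment, let $\mathsf k(x,y):=-\frac12\mathsf d^2(x,y)$, $(Kg)(x):=\int_X\mathsf k(x,y)g(y)\,d\mu(y)$, $Pg:=g-\int_Xg\,d\mu$ and $T:=PKP$ on $L^2(X,\mu)$; $T$ is a self-adjoint Hilbert--Schmidt operator. Let $\lambda_1^+(T)\ge\lambda_2^+(T)\ge\dots>0$ be its positive eigenvalues counted with multiplicity and $u_j^+(T)$ corresponding orthonormal eigenfunctions (identified with their continuous representatives). The infinite MDS map is $M(x):=(\sqrt{\lambda_j^+(T)}\,u_j^+(T)(x))_{j\ge1}$ (extended by zeros if there are finitely many positive eigenvalues), for any choice of the eigenfunctions. *)

theory Defs
  imports "HOL-Analysis.Analysis"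
begin

section \<open>The MDS operator of a metric measure space\<close>

text \<open>
  A metric measure space is given by a measure \<mu> on the carrier \<open>space \<mu>\<close> together with a
  metric \<open>d\<close> on that carrier.  Elements of L2 are represented by functions, and identities in L2
  are stated almost everywhere.
\<close>

definition mds_kernel :: "('a \<Rightarrow> 'a \<Rightarrow> real) \<Rightarrow> 'a \<Rightarrow> 'a \<Rightarrow> real" where
  "mds_kernel d x y = - (1/2) * (d x y)\<^sup>2"

definition mds_K :: "'a measure \<Rightarrow> ('a \<Rightarrow> 'a \<Rightarrow> real) \<Rightarrow> ('a \<Rightarrow> real) \<Rightarrow> 'a \<Rightarrow> real" where
  "mds_K \<mu> d g x = (\<integral>y. mds_kernel d x y * g y \<partial>\<mu>)"

definition mds_P :: "'a measure \<Rightarrow> ('a \<Rightarrow> real) \<Rightarrow> 'a \<Rightarrow> real" where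
  "mds_P \<mu> g x = g x - (\<integral>y. g y \<partial>\<mu>)"

definition mds_T :: "'a measure \<Rightarrow> ('a \<Rightarrow> 'a \<Rightarrow> real) \<Rightarrow> ('a \<Rightarrow> real) \<Rightarrow> 'a \<Rightarrow> real" where
  "mds_T \<mu> d g = mds_P \<mu> (mds_K \<mu> d (mds_P \<mu> g))"

definition square_integrable :: "'a measure \<Rightarrow> ('a \<Rightarrow> real) \<Rightarrow> bool" where
  "square_integrable \<mu> g \<longleftrightarrow> g \<in> borel_measurable \<mu> \<and> integrable \<mu> (\<lambda>x. (g x)\<^sup>2)"

definition mds_eigenspace :: "'a measure \<Rightarrow> ('a \<Rightarrow> 'a \<Rightarrow> real) \<Rightarrow> real \<Rightarrow> ('a \<Rightarrow> real) set" where
  "mds_eigenspace \<mu> d \<nu> =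
     {g. square_integrable \<mu> g \<and> (AE x in \<mu>. mds_T \<mu> d g x = \<nu> * g x)}"

text \<open>
  The positive eigenvalues of T in decreasing order, with orthonormal continuous eigenfunctions.
  The indices are the \<open>j\<close> with \<open>enat j < N\<close> (so \<open>N = \<infinity>\<close> if there are infinitely many), starting
  from 0.  The last clause, together with orthonormality, says that every positive eigenvalue is
  listed exactly as often as its multiplicity: the \<open>u j\<close> with \<open>lam j = \<nu>\<close> form an orthonormal
  basis of the eigenspace of \<open>\<nu>\<close> (and no \<open>\<nu>\<close> with a nonzero eigenspace is missed).
\<close>

definition positive_eigensystem ::
  "'a measure \<Rightarrow> ('a \<Rightarrow> 'a \<Rightarrow> real) \<Rightarrow> enat \<Rightarrow> (nat \<Rightarrow> real) \<Rightarrow> (nat \<Rightarrow> 'a \<Rightarrow> real) \<Rightarrow> bool" where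
  "positive_eigensystem \<mu> d N lam u \<longleftrightarrow>
     (\<forall>j. enat j < N \<longrightarrow>
        0 < lam j \<and> u j \<in> mds_eigenspace \<mu> d (lam j) \<and>
        continuous_map (Metric_space.mtopology (space \<mu>) d) euclideanreal (u j)) \<and>
     (\<forall>i j. i \<le> j \<longrightarrow> enat j < N \<longrightarrow> lam j \<le> lam i) \<and>
     (\<forall>i j. enat i < N \<longrightarrow> enat j < N \<longrightarrow>
        (\<integral>x. u i x * u j x \<partial>\<mu>) = (if i = j then 1 else 0)) \<and>
     (\<forall>\<nu>>0. finite {j. enat j < N \<and> lam j = \<nu>} \<and>
        (\<forall>g \<in> mds_eigenspace \<mu> d \<nu>. \<exists>c :: nat \<Rightarrow> real. AE x in \<mu>.
           g x = (\<Sum>j \<in> {j. enat j < N \<and> lam j = \<nu>}. c j * u j x)))"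

definition infinite_mds_map ::
  "'a measure \<Rightarrow> ('a \<Rightarrow> 'a \<Rightarrow> real) \<Rightarrow> ('a \<Rightarrow> nat \<Rightarrow> real) \<Rightarrow> bool" where
  "infinite_mds_map \<mu> d M \<longleftrightarrow>
     (\<exists>N lam u. positive_eigensystem \<mu> d N lam u \<and>
        M = (\<lambda>x j. if enat j < N then sqrt (lam j) * u j x else 0))"


section \<open>The sequence space and bi-Hoelder maps\<close>

definition ell2 :: "(nat \<Rightarrow> real) set" where
  "ell2 = {a. summable (\<lambda>j. (a j)\<^sup>2)}"

definition ell2_norm :: "(nat \<Rightarrow> real) \<Rightarrow> real" where
  "ell2_norm a = sqrt (\<Sum>j. (a j)\<^sup>2)"

definition ell2_dist :: "(nat \<Rightarrow> real) \<Rightarrow> (nat \<Rightarrow> real) \<Rightarrow> real" where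
  "ell2_dist a b = ell2_norm (\<lambda>j. a j - b j)"

text \<open>
  Both \<open>f\<close> and its inverse on the image are Hoelder continuous.  Injectivity of \<open>f\<close> on \<open>X\<close> is
  implied by the second inequality, as \<open>0 powr \<beta> = 0\<close>.
\<close>

definition bi_hoelder_on ::
  "'a set \<Rightarrow> ('a \<Rightarrow> 'a \<Rightarrow> real) \<Rightarrow> ('b \<Rightarrow> 'b \<Rightarrow> real) \<Rightarrow> ('a \<Rightarrow> 'b) \<Rightarrow> bool" where
  "bi_hoelder_on X d d' f \<longleftrightarrow>
     (\<exists>C>0. \<exists>\<alpha> \<beta>. 0 < \<alpha> \<and> \<alpha> \<le> 1 \<and> 0 < \<beta> \<and> \<beta> \<le> 1 \<and>
        (\<forall>x\<in>X. \<forall>y\<in>X. d' (f x) (f y) \<le> C * d x y powr \<alpha> \<and>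
                      d x y \<le> C * d' (f x) (f y) powr \<beta>))"


section \<open>The flat torus\<close>

abbreviation circle :: "complex set" where
  "circle \<equiv> sphere 0 1"

text \<open>
  The geodesic distance: the infimum of the lengths of the continuously differentiable curves
  in the circle that join two given points.
\<close>

definition circle_dist :: "complex \<Rightarrow> complex \<Rightarrow> real" where
  "circle_dist x y =
     Inf {integral {0..1} (\<lambda>t. norm (vector_derivative g (at t))) | g.
            g C1_differentiable_on {0..1} \<and> g ` {0..1} \<subseteq> circle \<and> g 0 = x \<and> g 1 = y}"

text \<open>Normalized arc length; \<open>cis\<close> parametrizes the circle by arc length.\<close>

definition circle_measure :: "complex measure" where
  "circle_measure = distr (uniform_measure lborel {0..<2*pi}) (restrict_space borel circle) cis"

definition flat_torus :: "(complex \<times> complex) set" where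
  "flat_torus = circle \<times> circle"

definition torus_dist :: "complex \<times> complex \<Rightarrow> complex \<times> complex \<Rightarrow> real" where
  "torus_dist x y =
     sqrt ((circle_dist (fst x) (fst y))\<^sup>2 + (circle_dist (snd x) (snd y))\<^sup>2)"

text \<open>The normalized volume of the product metric; its carrier is the flat torus.\<close>

definition torus_measure :: "(complex \<times> complex) measure" where
  "torus_measure = circle_measure \<Otimes>\<^sub>M circle_measure"

end

theory Submission
  imports Defs "HOL-Probability.Probability_Measure" "HOL-Complex_Analysis.Winding_Numbers"
begin

text \<open>
  On \<open>[-\<pi>, \<pi>]\<close> one has \<open>-t\<^sup>2/2 = -\<pi>\<^sup>2/6 + 2 \<Sum>\<^sub>m (-1)\<^sup>m\<^sup>+\<^sup>1 cos (m t) / m\<^sup>2\<close>, and the kernel of the torus is the sum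
  of two such functions of the coordinate differences.  So T is diagonal in the characters that depend
  on one coordinate only: the frequency \<open>m \<ge> 1\<close> has the eigenvalue \<open>(-1)\<^sup>m\<^sup>+\<^sup>1/m\<^sup>2\<close> with multiplicity 4,
  which is positive exactly for odd \<open>m\<close>.  The sum of \<open>(u x - u y)\<^sup>2\<close> over an orthonormal basis of an
  eigenspace does not depend on the basis, so any MDS map has the squared distances
  \<open>\<Sum>\<^sub>m (4/m\<^sup>2) ((1 - cos (m s)) + (1 - cos (m t)))\<close>, the sum being over the odd \<open>m\<close> and \<open>s\<close>, \<open>t\<close> being
  the angles between the coordinates; this is \<open>\<pi> (\<bar>s\<bar> + \<bar>t\<bar>)\<close>.
\<close>

section \<open>MDS operators with a diagonal kernel\<close>

text \<open>An eigenfunction \<open>g\<close> of an eigenvalue \<open>\<nu> \<noteq> 0\<close>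
  equals \<open>T g / \<nu>\<close>, and the kernel expansion writes \<open>T g\<close> everywhere
  as a series of the functions \<open>\<phi> n r\<close>. This forces \<open>g\<close> into their
  span and rules out nonzero eigenvalues outside the range of \<open>\<kappa>\<close>. Injectivity
  of \<open>\<kappa>\<close> makes each block of nonzero eigenvalue exactly one eigenspace; absolute
  summability of \<open>\<kappa>\<close> and the bound \<open>B\<close> justify exchanging sums and
  integrals. Two gaps separate this from the MDS map. Eigenfunctions are known only almost
  everywhere, but the map is evaluated at points, so continuity and the density of sets of full
  measure enter. The eigensystem is ordered by size of eigenvalue, the expansion by frequency, so
  series of nonnegative terms are regrouped as unordered sums. One cosine series serves twice:
  shifted by \<open>pi\<close> it expands the kernel, and half the sum of the original and the
  alternating series keeps the odd frequencies. In that sum the quadratic terms cancel and only the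
  absolute value of the angle survives; hence the squared MDS distance is linear in the coordinate
  distances.\<close>

locale kernel_expansion = prob_space \<mu> for \<mu> :: "'a measure" +
  fixes d :: "'a \<Rightarrow> 'a \<Rightarrow> real" and c :: real and \<kappa> :: "nat \<Rightarrow> real"
    and \<phi> :: "nat \<Rightarrow> 'r \<Rightarrow> 'a \<Rightarrow> real" and R :: "'r set" and B :: real
  assumes finite_R: "finite R"
    and summable_\<kappa>: "summable (\<lambda>n. \<bar>\<kappa> n\<bar>)"
    and inj_\<kappa>: "inj \<kappa>"
    and measurable_\<phi> [measurable]: "r \<in> R \<Longrightarrow> \<phi> n r \<in> borel_measurable \<mu>"
    and bounded_\<phi>: "r \<in> R \<Longrightarrow> x \<in> space \<mu> \<Longrightarrow> \<bar>\<phi> n r x\<bar> \<le> B"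
    and mean_\<phi>: "r \<in> R \<Longrightarrow> (\<integral>x. \<phi> n r x \<partial>\<mu>) = 0"
    and orthonormal_\<phi>: "r \<in> R \<Longrightarrow> s \<in> R \<Longrightarrow>
      (\<integral>x. \<phi> n r x * \<phi> m s x \<partial>\<mu>) = (if n = m \<and> r = s then 1 else 0)"
    and kernel_eq: "x \<in> space \<mu> \<Longrightarrow> y \<in> space \<mu> \<Longrightarrow>
      mds_kernel d x y = c + (\<Sum>n. \<kappa> n * (\<Sum>r\<in>R. \<phi> n r x * \<phi> n r y))"
begin

section \<open>Bounds and termwise integration of the kernel series\<close>

lemma bound_nonneg: "r \<in> R \<Longrightarrow> 0 \<le> B"
  using bounded_\<phi> not_empty by fastforce

lemma integrable_\<phi>_mult:
  assumes "integrable \<mu> f" "r \<in> R"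
  shows "integrable \<mu> (\<lambda>x. \<phi> n r x * f x)"
proof (rule Bochner_Integration.integrable_bound)
  show "integrable \<mu> (\<lambda>x. B * f x)"
    using assms by simp
  show "AE x in \<mu>. norm (\<phi> n r x * f x) \<le> norm (B * f x)"
    using bounded_\<phi>[OF assms(2)] bound_nonneg[OF assms(2)]
    by (intro AE_I2) (auto simp: abs_mult intro!: mult_right_mono)
qed (use assms in measurable)

lemma term_bound:
  assumes "\<And>r. r \<in> R \<Longrightarrow> \<bar>a r\<bar> \<le> A" "x \<in> space \<mu>"
  shows "\<bar>\<kappa> n * (\<Sum>r\<in>R. a r * \<phi> n r x)\<bar> \<le> \<bar>\<kappa> n\<bar> * (card R * (A * B))"
proof -
  have "\<bar>\<Sum>r\<in>R. a r * \<phi> n r x\<bar> \<le> (\<Sum>r\<in>R. A * B)"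
    by (rule order_trans[OF sum_abs], rule sum_mono)
       (metis abs_ge_zero abs_mult assms bounded_\<phi> mult_mono' )
  then show ?thesis
    by (simp add: abs_mult mult_left_mono)
qed

lemma summable_terms:
  assumes "\<And>n r. r \<in> R \<Longrightarrow> \<bar>a n r\<bar> \<le> A" "x \<in> space \<mu>"
  shows "summable (\<lambda>n. \<bar>\<kappa> n * (\<Sum>r\<in>R. a n r * \<phi> n r x)\<bar>)"
proof (rule summable_comparison_test)
  show "summable (\<lambda>n. \<bar>\<kappa> n\<bar> * (card R * (A * B)))"
    using summable_\<kappa> by (rule summable_mult2)
  show "\<exists>N. \<forall>n\<ge>N. norm \<bar>\<kappa> n * (\<Sum>r\<in>R. a n r * \<phi> n r x)\<bar> \<le> \<bar>\<kappa> n\<bar> * (card R * (A * B))"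
    using term_bound[of "a _" A x] assms by auto
qed

text \<open>Two coefficient arrays will be inserted for \<open>a\<close>: the values
  \<open>\<phi> n r z\<close> at a fixed point, and the coefficients of an integrable function. Both
  are uniformly bounded, so the terms are dominated by multiples
  \<open>\<bar>\<kappa> n\<bar>\<close> of one integrable function.\<close>

lemma integral_series:
  assumes a: "\<And>n r. r \<in> R \<Longrightarrow> \<bar>a n r\<bar> \<le> A" and f: "integrable \<mu> f"
  shows "(\<integral>x. (\<Sum>n. \<kappa> n * (\<Sum>r\<in>R. a n r * \<phi> n r x)) * f x \<partial>\<mu>) =
    (\<Sum>n. \<kappa> n * (\<Sum>r\<in>R. a n r * (\<integral>x. \<phi> n r x * f x \<partial>\<mu>)))"
proof -
  define G where "G n x = \<kappa> n * (\<Sum>r\<in>R. a n r * \<phi> n r x) * f x" for n x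
  have G_eq: "G n x = (\<Sum>r\<in>R. (\<kappa> n * a n r) * (\<phi> n r x * f x))" for n x
    by (simp add: G_def sum_distrib_left sum_distrib_right algebra_simps)
  have G_int: "integrable \<mu> (G n)" for n
    unfolding G_eq by (intro Bochner_Integration.integrable_sum integrable_mult_right integrable_\<phi>_mult f)
  have G_integral: "(\<integral>x. G n x \<partial>\<mu>) = \<kappa> n * (\<Sum>r\<in>R. a n r * (\<integral>x. \<phi> n r x * f x \<partial>\<mu>))" for n
    unfolding G_eq
    by (subst Bochner_Integration.integral_sum)
       (auto intro!: integrable_mult_right integrable_\<phi>_mult f simp: sum_distrib_left mult.assoc)
  have G_summable: "summable (\<lambda>n. norm (G n x))" if "x \<in> space \<mu>" for x
    using summable_mult2[OF summable_terms[of a A x], of "\<bar>f x\<bar>"] a that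
    by (simp add: G_def abs_mult)
  have G_bound: "norm (G n x) \<le> \<bar>\<kappa> n\<bar> * (card R * (A * B)) * \<bar>f x\<bar>" if "x \<in> space \<mu>" for n x
    unfolding G_def real_norm_def abs_mult[of _ "f x"]
    by (intro mult_right_mono term_bound a that) auto
  have "summable (\<lambda>n. \<integral>x. norm (G n x) \<partial>\<mu>)"
  proof (rule summable_comparison_test)
    show "summable (\<lambda>n. \<bar>\<kappa> n\<bar> * ((card R * (A * B)) * (\<integral>x. \<bar>f x\<bar> \<partial>\<mu>)))"
      using summable_\<kappa> by (rule summable_mult2)
    have "(\<integral>x. norm (G n x) \<partial>\<mu>) \<le> (\<integral>x. \<bar>\<kappa> n\<bar> * (card R * (A * B)) * \<bar>f x\<bar> \<partial>\<mu>)" for n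
      by (intro integral_mono integrable_mult_right integrable_norm G_int integrable_abs f G_bound)
    then show "\<exists>N. \<forall>n\<ge>N. norm (\<integral>x. norm (G n x) \<partial>\<mu>)
        \<le> \<bar>\<kappa> n\<bar> * ((card R * (A * B)) * (\<integral>x. \<bar>f x\<bar> \<partial>\<mu>))"
      by (simp add: mult.assoc)
  qed
  then have "(\<integral>x. (\<Sum>n. G n x) \<partial>\<mu>) = (\<Sum>n. \<integral>x. G n x \<partial>\<mu>)"
    using G_summable by (intro integral_suminf G_int AE_I2)
  moreover have "(\<integral>x. (\<Sum>n. G n x) \<partial>\<mu>) =
      (\<integral>x. (\<Sum>n. \<kappa> n * (\<Sum>r\<in>R. a n r * \<phi> n r x)) * f x \<partial>\<mu>)"
  proof (rule Bochner_Integration.integral_cong)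
    fix x assume "x \<in> space \<mu>"
    then have "summable (\<lambda>n. \<kappa> n * (\<Sum>r\<in>R. a n r * \<phi> n r x))"
      using summable_terms[of a A x] a by (simp add: summable_rabs_cancel)
    then show "(\<Sum>n. G n x) = (\<Sum>n. \<kappa> n * (\<Sum>r\<in>R. a n r * \<phi> n r x)) * f x"
      unfolding G_def by (simp add: suminf_mult2)
  qed simp
  ultimately show ?thesis
    by (simp add: G_integral)
qed

lemma coefficient_bound:
  assumes "integrable \<mu> f" "r \<in> R"
  shows "\<bar>\<integral>x. \<phi> n r x * f x \<partial>\<mu>\<bar> \<le> B * (\<integral>x. \<bar>f x\<bar> \<partial>\<mu>)"
proof -
  have "\<bar>\<integral>x. \<phi> n r x * f x \<partial>\<mu>\<bar> \<le> (\<integral>x. \<bar>\<phi> n r x * f x\<bar> \<partial>\<mu>)"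
    by simp
  also have "\<dots> \<le> (\<integral>x. B * \<bar>f x\<bar> \<partial>\<mu>)"
    using assms bounded_\<phi>
    by (intro integral_mono integrable_abs integrable_\<phi>_mult integrable_mult_right)
       (auto simp: abs_mult intro!: mult_right_mono)
  finally show ?thesis by simp
qed

section \<open>The operator in coordinates and its eigenspaces\<close>

lemma square_integrable_integrable:
  assumes "square_integrable \<mu> g"
  shows "integrable \<mu> g"
  using assms unfolding square_integrable_def
  by (simp add: square_integrable_imp_integrable)

text \<open>Both projections affect constants only. Centring \<open>g\<close> kills the constant
  \<open>c\<close> of the kernel and keeps the coefficients, because each \<open>\<phi> n r\<close>
  has mean 0; for the same reason the resulting series has mean 0, and the outer projection fixes
  it.\<close>

lemma mds_T_eq:
  assumes g: "integrable \<mu> g" and x: "x \<in> space \<mu>"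
  shows "mds_T \<mu> d g x = (\<Sum>n. \<kappa> n * (\<Sum>r\<in>R. (\<integral>y. \<phi> n r y * g y \<partial>\<mu>) * \<phi> n r x))"
proof -
  define b where "b n r = (\<integral>y. \<phi> n r y * g y \<partial>\<mu>)" for n r
  define h where "h = mds_P \<mu> g"
  have h: "integrable \<mu> h"
    unfolding h_def mds_P_def[abs_def] using g by simp
  have h_mean: "(\<integral>y. h y \<partial>\<mu>) = 0"
    unfolding h_def mds_P_def[abs_def] using g by (simp add: prob_space)
  have h_coeff: "(\<integral>y. \<phi> n r y * h y \<partial>\<mu>) = b n r" if "r \<in> R" for n r
  proof -
    have "(\<lambda>y. \<phi> n r y * h y) = (\<lambda>y. \<phi> n r y * g y - \<phi> n r y * (\<integral>y. g y \<partial>\<mu>))"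
      unfolding h_def mds_P_def[abs_def] by (simp add: algebra_simps)
    moreover have "integrable \<mu> (\<phi> n r)"
      using integrable_\<phi>_mult[of "\<lambda>_. 1" r n] that by simp
    ultimately show ?thesis
      using integrable_\<phi>_mult[OF g that] that by (simp add: b_def mean_\<phi>)
  qed
  have K_eq: "mds_K \<mu> d h z = (\<Sum>n. \<kappa> n * (\<Sum>r\<in>R. b n r * \<phi> n r z))" if z: "z \<in> space \<mu>" for z
  proof -
    let ?S = "\<lambda>y. \<Sum>n. \<kappa> n * (\<Sum>r\<in>R. \<phi> n r z * \<phi> n r y)"
    have "mds_K \<mu> d h z = (\<integral>y. c * h y + ?S y * h y \<partial>\<mu>)"
      unfolding mds_K_def
      by (rule Bochner_Integration.integral_cong) (simp_all add: kernel_eq z algebra_simps)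
    also have "\<dots> = c * (\<integral>y. h y \<partial>\<mu>) + (\<integral>y. ?S y * h y \<partial>\<mu>)"
    proof (subst Bochner_Integration.integral_add)
      show "integrable \<mu> (\<lambda>y. ?S y * h y)"
      proof (rule Bochner_Integration.integrable_bound)
        let ?C = "\<Sum>n. \<bar>\<kappa> n\<bar> * (card R * (B * B))"
        show "integrable \<mu> (\<lambda>y. ?C * h y)"
          using h by simp
        show "(\<lambda>y. ?S y * h y) \<in> borel_measurable \<mu>"
          using h by measurable
        have "\<bar>?S y\<bar> \<le> ?C" if y: "y \<in> space \<mu>" for y
        proof -
          have s: "summable (\<lambda>n. \<bar>\<kappa> n * (\<Sum>r\<in>R. \<phi> n r z * \<phi> n r y)\<bar>)"
            by (rule summable_terms[OF bounded_\<phi>[OF _ z] y])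
          have "\<bar>?S y\<bar> \<le> (\<Sum>n. \<bar>\<kappa> n * (\<Sum>r\<in>R. \<phi> n r z * \<phi> n r y)\<bar>)"
            by (rule summable_rabs[OF s])
          also have "\<dots> \<le> ?C"
            by (intro suminf_le term_bound bounded_\<phi> y z s summable_mult2 summable_\<kappa>)
          finally show ?thesis .
        qed
        then show "AE y in \<mu>. norm (?S y * h y) \<le> norm (?C * h y)"
          by (intro AE_I2) (fastforce simp: abs_mult intro!: mult_right_mono)
      qed
    qed (use h in auto)
    also have "(\<integral>y. ?S y * h y \<partial>\<mu>) = (\<Sum>n. \<kappa> n * (\<Sum>r\<in>R. \<phi> n r z * b n r))"
      by (subst integral_series[where A = B]) (auto simp: bounded_\<phi> z h h_coeff)
    finally show ?thesis
      by (simp add: h_mean mult.commute)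
  qed
  have "(\<integral>z. mds_K \<mu> d h z \<partial>\<mu>) = (\<integral>z. (\<Sum>n. \<kappa> n * (\<Sum>r\<in>R. b n r * \<phi> n r z)) * 1 \<partial>\<mu>)"
    by (rule Bochner_Integration.integral_cong) (simp_all add: K_eq)
  also have "\<dots> = (\<Sum>n. \<kappa> n * (\<Sum>r\<in>R. b n r * (\<integral>z. \<phi> n r z * 1 \<partial>\<mu>)))"
    by (rule integral_series[where A = "B * (\<integral>x. \<bar>g x\<bar> \<partial>\<mu>)"])
       (auto simp: b_def intro: coefficient_bound g)
  also have "\<dots> = 0"
    by (simp add: mean_\<phi>)
  finally show ?thesis
    using K_eq[OF x] by (simp add: mds_T_def h_def[symmetric] mds_P_def[of \<mu> "mds_K \<mu> d h"] b_def)
qed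

lemma mds_T_coefficient:
  assumes g: "integrable \<mu> g" and s: "s \<in> R"
  shows "(\<integral>x. \<phi> m s x * mds_T \<mu> d g x \<partial>\<mu>) = \<kappa> m * (\<integral>x. \<phi> m s x * g x \<partial>\<mu>)"
proof -
  define b where "b n r = (\<integral>y. \<phi> n r y * g y \<partial>\<mu>)" for n r
  have "(\<integral>x. \<phi> m s x * mds_T \<mu> d g x \<partial>\<mu>) =
      (\<integral>x. (\<Sum>n. \<kappa> n * (\<Sum>r\<in>R. b n r * \<phi> n r x)) * \<phi> m s x \<partial>\<mu>)"
    by (rule Bochner_Integration.integral_cong) (simp_all add: mds_T_eq g b_def)
  also have "\<dots> = (\<Sum>n. \<kappa> n * (\<Sum>r\<in>R. b n r * (\<integral>x. \<phi> n r x * \<phi> m s x \<partial>\<mu>)))"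
    using integrable_\<phi>_mult[of "\<lambda>_. 1" s m] s
    by (intro integral_series[where A = "B * (\<integral>x. \<bar>g x\<bar> \<partial>\<mu>)"])
       (auto simp: b_def intro: coefficient_bound g)
  also have "\<dots> = (\<Sum>n. if n = m then \<kappa> m * b m s else 0)"
  proof (rule suminf_cong)
    fix n
    have "(\<Sum>r\<in>R. b n r * (\<integral>x. \<phi> n r x * \<phi> m s x \<partial>\<mu>)) = (\<Sum>r\<in>R. if r = s then (if n = m then b m s else 0) else 0)"
      by (rule sum.cong) (auto simp: orthonormal_\<phi> s)
    also have "\<dots> = (if n = m then b m s else 0)"
      using s finite_R by simp
    finally show "\<kappa> n * (\<Sum>r\<in>R. b n r * (\<integral>x. \<phi> n r x * \<phi> m s x \<partial>\<mu>)) = (if n = m then \<kappa> m * b m s else 0)"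
      by simp
  qed
  also have "\<dots> = \<kappa> m * b m s"
    using suminf_finite[of "{m}" "\<lambda>n. if n = m then \<kappa> m * b m s else 0"] by simp
  finally show ?thesis
    by (simp add: b_def)
qed

text \<open>Testing \<open>T g = \<nu> g\<close> against \<open>\<phi> m s\<close> multiplies its
  coefficient by \<open>\<kappa> m\<close> on one side and by \<open>\<nu>\<close> on the
  other.\<close>

lemma eigenspace_coefficient:
  assumes g: "g \<in> mds_eigenspace \<mu> d \<nu>" and s: "s \<in> R" and "\<kappa> m \<noteq> \<nu>"
  shows "(\<integral>x. \<phi> m s x * g x \<partial>\<mu>) = 0"
proof -
  have gi: "integrable \<mu> g" and gT: "AE x in \<mu>. mds_T \<mu> d g x = \<nu> * g x"
    using g square_integrable_integrable by (auto simp: mds_eigenspace_def)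
  have "(\<integral>x. \<phi> m s x * mds_T \<mu> d g x \<partial>\<mu>) = (\<integral>x. \<nu> * (\<phi> m s x * g x) \<partial>\<mu>)"
  proof (rule integral_cong_AE)
    \<comment> \<open>The eigenvalue equation holds only almost everywhere, so integrating it
      requires measurability of \<open>mds_T \<mu> d g\<close>, which is read off from the
      series.\<close>
    have "(\<lambda>x. \<Sum>n. \<kappa> n * (\<Sum>r\<in>R. (\<integral>y. \<phi> n r y * g y \<partial>\<mu>) * \<phi> n r x)) \<in> borel_measurable \<mu>"
      by measurable
    then have [measurable]: "mds_T \<mu> d g \<in> borel_measurable \<mu>"
      by (subst measurable_cong[OF mds_T_eq[OF gi]])
    show "(\<lambda>x. \<phi> m s x * mds_T \<mu> d g x) \<in> borel_measurable \<mu>"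
      using s by measurable
    show "(\<lambda>x. \<nu> * (\<phi> m s x * g x)) \<in> borel_measurable \<mu>"
      using s gi by measurable
    show "AE x in \<mu>. \<phi> m s x * mds_T \<mu> d g x = \<nu> * (\<phi> m s x * g x)"
      using gT by eventually_elim (simp add: algebra_simps)
  qed
  then show ?thesis
    using mds_T_coefficient[OF gi s] assms(3) by simp
qed

text \<open>The series for \<open>T g\<close> collapses to the block \<open>n\<close>, since all
  other coefficients of \<open>g\<close> vanish; dividing by \<open>\<kappa> n\<close> recovers
  \<open>g\<close>.\<close>

lemma eigenspace_expansion:
  assumes g: "g \<in> mds_eigenspace \<mu> d (\<kappa> n)" and "\<kappa> n \<noteq> 0"
  shows "AE x in \<mu>. g x = (\<Sum>r\<in>R. (\<integral>y. \<phi> n r y * g y \<partial>\<mu>) * \<phi> n r x)"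
proof -
  have gi: "integrable \<mu> g" and gT: "AE x in \<mu>. mds_T \<mu> d g x = \<kappa> n * g x"
    using g square_integrable_integrable by (auto simp: mds_eigenspace_def)
  have "mds_T \<mu> d g x = \<kappa> n * (\<Sum>r\<in>R. (\<integral>y. \<phi> n r y * g y \<partial>\<mu>) * \<phi> n r x)" if "x \<in> space \<mu>" for x
  proof -
    have "\<kappa> m \<noteq> \<kappa> n" if "m \<noteq> n" for m
      using inj_\<kappa> that by (auto dest: injD)
    then show ?thesis
      unfolding mds_T_eq[OF gi that]
      by (subst suminf_finite[of "{n}"]) (auto simp: eigenspace_coefficient[OF g])
  qed
  note pointwise = this
  show ?thesis
    using AE_space gT by eventually_elim (use assms(2) pointwise in simp)
qed

lemma eigenvalue_in_range:
  assumes g: "g \<in> mds_eigenspace \<mu> d \<nu>" and "\<nu> \<noteq> 0" and "\<nu> \<notin> range \<kappa>"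
  shows "AE x in \<mu>. g x = 0"
proof -
  have gi: "integrable \<mu> g" and gT: "AE x in \<mu>. mds_T \<mu> d g x = \<nu> * g x"
    using g square_integrable_integrable by (auto simp: mds_eigenspace_def)
  have "mds_T \<mu> d g x = 0" if "x \<in> space \<mu>" for x
  proof -
    have "\<kappa> n \<noteq> \<nu>" for n
      using assms(3) by auto
    then show ?thesis
      by (simp add: mds_T_eq[OF gi that] eigenspace_coefficient[OF g])
  qed
  note pointwise = this
  show ?thesis
    using AE_space gT by eventually_elim (use assms(2) pointwise in simp)
qed

lemma \<phi>_eigenfunction:
  assumes s: "s \<in> R"
  shows "\<phi> m s \<in> mds_eigenspace \<mu> d (\<kappa> m)"
proof -
  have int: "integrable \<mu> (\<phi> m s)"
    using integrable_\<phi>_mult[of "\<lambda>_. 1" s m] s by simp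
  have "square_integrable \<mu> (\<phi> m s)"
    using integrable_\<phi>_mult[OF int s, of m] s by (simp add: square_integrable_def power2_eq_square)
  moreover have "mds_T \<mu> d (\<phi> m s) x = \<kappa> m * \<phi> m s x" if "x \<in> space \<mu>" for x
  proof -
    have "(\<Sum>r\<in>R. (\<integral>y. \<phi> n r y * \<phi> m s y \<partial>\<mu>) * \<phi> n r x) = (if n = m then \<phi> m s x else 0)" for n
    proof -
      have "(\<Sum>r\<in>R. (\<integral>y. \<phi> n r y * \<phi> m s y \<partial>\<mu>) * \<phi> n r x) =
          (\<Sum>r\<in>R. if r = s then (if n = m then \<phi> m s x else 0) else 0)"
        by (rule sum.cong) (auto simp: orthonormal_\<phi> s)
      then show ?thesis
        using s finite_R by simp
    qed
    then show ?thesis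
      unfolding mds_T_eq[OF int that] by (subst suminf_finite[of "{m}"]) auto
  qed
  ultimately show ?thesis
    by (auto simp: mds_eigenspace_def)
qed


section \<open>Independence of the choice of eigenfunctions\<close>

lemma sum_two_points:
  fixes q :: "'i \<Rightarrow> real"
  assumes "\<And>z. z \<in> X \<Longrightarrow> f z = (\<Sum>i\<in>I. q i * g i z)" "x \<in> X" "y \<in> X"
  shows "a * f x + b * f y = (\<Sum>i\<in>I. q i * (a * g i x + b * g i y))"
  by (simp add: assms sum_distrib_left sum.distrib algebra_simps)

text \<open>The pair \<open>a = 1\<close>, \<open>b = 0\<close> yields squared norms of the MDS map,
  and \<open>a = 1\<close>, \<open>b = -1\<close> squared distances. The hypothesis
  \<open>faithful\<close> turns equalities almost everywhere between continuous functions into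
  equalities at \<open>x\<close> and \<open>y\<close>.\<close>

lemma positive_eigensystem_sums:
  assumes sys: "positive_eigensystem \<mu> d N lam u"
    and faithful: "\<And>f g z. continuous_map (Metric_space.mtopology (space \<mu>) d) euclideanreal f \<Longrightarrow>
      continuous_map (Metric_space.mtopology (space \<mu>) d) euclideanreal g \<Longrightarrow>
      AE w in \<mu>. f w = g w \<Longrightarrow> z \<in> space \<mu> \<Longrightarrow> f z = g z"
    and continuous_\<phi>: "\<And>n r. r \<in> R \<Longrightarrow>
      continuous_map (Metric_space.mtopology (space \<mu>) d) euclideanreal (\<phi> n r)"
    and x: "x \<in> space \<mu>" and y: "y \<in> space \<mu>"
    and S: "(\<lambda>n. if 0 < \<kappa> n then \<kappa> n * (\<Sum>r\<in>R. (a * \<phi> n r x + b * \<phi> n r y)\<^sup>2) else 0) sums S"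
  shows "(\<lambda>j. if enat j < N then lam j * (a * u j x + b * u j y)\<^sup>2 else 0) sums S"
proof -
  define L where "L f = a * f x + b * f y" for f :: "'a \<Rightarrow> real"
  define J where "J n = {j. enat j < N \<and> lam j = \<kappa> n}" for n
  define \<alpha> where "\<alpha> n j r = (\<integral>z. \<phi> n r z * u j z \<partial>\<mu>)" for n j r
  define P where "P = {n. 0 < \<kappa> n}"
  have lam_pos: "0 < lam j" and u_eig: "u j \<in> mds_eigenspace \<mu> d (lam j)"
    and u_cont: "continuous_map (Metric_space.mtopology (space \<mu>) d) euclideanreal (u j)"
    if "enat j < N" for j
    using sys that by (auto simp: positive_eigensystem_def)
  have u_ortho: "(\<integral>z. u i z * u j z \<partial>\<mu>) = (if i = j then 1 else 0)"
    if "enat i < N" "enat j < N" for i j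
    using sys that by (auto simp: positive_eigensystem_def)
  have J_finite: "finite (J n)"
    and J_span: "g \<in> mds_eigenspace \<mu> d (\<kappa> n) \<Longrightarrow> \<exists>c. AE z in \<mu>. g z = (\<Sum>j\<in>J n. c j * u j z)"
    if "n \<in> P" for n g
    using sys that by (auto simp: positive_eigensystem_def J_def P_def)
  have u_prod: "integrable \<mu> (\<lambda>z. u i z * u j z)" if "enat i < N" "enat j < N" for i j
  proof (rule Bochner_Integration.integrable_bound)
    have [measurable]: "u i \<in> borel_measurable \<mu>" "u j \<in> borel_measurable \<mu>"
      and sq: "integrable \<mu> (\<lambda>z. (u i z)\<^sup>2)" "integrable \<mu> (\<lambda>z. (u j z)\<^sup>2)"
      using u_eig that by (auto simp: mds_eigenspace_def square_integrable_def)
    show "integrable \<mu> (\<lambda>z. (u i z)\<^sup>2 + (u j z)\<^sup>2)"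
      using sq by simp
    show "(\<lambda>z. u i z * u j z) \<in> borel_measurable \<mu>"
      by measurable
    have "\<bar>s * t\<bar> \<le> s\<^sup>2 + t\<^sup>2" for s t :: real
      using sum_squares_bound[of "\<bar>s\<bar>" "\<bar>t\<bar>"] mult_nonneg_nonneg[of "\<bar>s\<bar>" "\<bar>t\<bar>"]
      unfolding power2_abs abs_mult by linarith
    then show "AE z in \<mu>. norm (u i z * u j z) \<le> norm ((u i z)\<^sup>2 + (u j z)\<^sup>2)"
      by simp
  qed
  have L_u: "L (u j) = (\<Sum>r\<in>R. \<alpha> n j r * L (\<phi> n r))" if n: "n \<in> P" and j: "j \<in> J n" for n j
    unfolding L_def
  proof (rule sum_two_points[OF faithful x y])
    show "continuous_map (Metric_space.mtopology (space \<mu>) d) euclideanreal (u j)"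
      using u_cont j by (simp add: J_def)
    show "continuous_map (Metric_space.mtopology (space \<mu>) d) euclideanreal
        (\<lambda>z. \<Sum>r\<in>R. \<alpha> n j r * \<phi> n r z)"
      by (intro continuous_map_sum finite_R continuous_map_real_mult_left continuous_\<phi>)
    show "AE z in \<mu>. u j z = (\<Sum>r\<in>R. \<alpha> n j r * \<phi> n r z)"
      using eigenspace_expansion[of "u j" n] u_eig[of j] n j by (simp add: J_def P_def \<alpha>_def)
  qed
  \<comment> \<open>The same matrix \<open>\<alpha>\<close> expands the waves in the eigenfunctions:
    some coefficients \<open>q\<close> exist by the spanning clause of the eigensystem, and
    orthonormality of the \<open>u j\<close> identifies them.\<close>
  have L_\<phi>: "L (\<phi> n r) = (\<Sum>j\<in>J n. \<alpha> n j r * L (u j))" if n: "n \<in> P" and r: "r \<in> R" for n r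
    unfolding L_def
  proof (rule sum_two_points[OF faithful x y])
    show "continuous_map (Metric_space.mtopology (space \<mu>) d) euclideanreal (\<phi> n r)"
      using r by (rule continuous_\<phi>)
    show "continuous_map (Metric_space.mtopology (space \<mu>) d) euclideanreal
        (\<lambda>z. \<Sum>j\<in>J n. \<alpha> n j r * u j z)"
      using n by (intro continuous_map_sum J_finite continuous_map_real_mult_left u_cont)
        (auto simp: J_def)
    obtain q where q: "AE z in \<mu>. \<phi> n r z = (\<Sum>j\<in>J n. q j * u j z)"
      using J_span[OF n \<phi>_eigenfunction[OF r]] by blast
    have "\<alpha> n i r = q i" if i: "i \<in> J n" for i
    proof -
      have "\<alpha> n i r = (\<integral>z. (\<Sum>j\<in>J n. q j * (u j z * u i z)) \<partial>\<mu>)"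
        unfolding \<alpha>_def
      proof (rule integral_cong_AE)
        have [measurable]: "u j \<in> borel_measurable \<mu>" if "j \<in> J n" for j
          using u_eig that by (auto simp: mds_eigenspace_def square_integrable_def J_def)
        show "(\<lambda>z. \<phi> n r z * u i z) \<in> borel_measurable \<mu>"
          using i r by measurable
        show "(\<lambda>z. \<Sum>j\<in>J n. q j * (u j z * u i z)) \<in> borel_measurable \<mu>"
          using i by measurable
        show "AE z in \<mu>. \<phi> n r z * u i z = (\<Sum>j\<in>J n. q j * (u j z * u i z))"
          using q by eventually_elim (simp add: sum_distrib_right mult.assoc)
      qed
      also have "\<dots> = (\<Sum>j\<in>J n. q j * (\<integral>z. u j z * u i z \<partial>\<mu>))"
        using i by (subst Bochner_Integration.integral_sum) (auto simp: J_def u_prod)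
      also have "\<dots> = (\<Sum>j\<in>J n. if j = i then q j else 0)"
        using i by (intro sum.cong) (auto simp: J_def u_ortho)
      also have "\<dots> = q i"
        using i J_finite[OF n] by simp
      finally show ?thesis .
    qed
    then show "AE z in \<mu>. \<phi> n r z = (\<Sum>j\<in>J n. \<alpha> n j r * u j z)"
      using q by simp
  qed
  \<comment> \<open>Expand one factor of each square in the waves and sum over \<open>j\<close>
    first: the other factors recombine to \<open>L (\<phi> n r)\<close>. Two mutually inverse
    expansions thus replace a comparison of dimensions.\<close>
  have block: "(\<Sum>j\<in>J n. (L (u j))\<^sup>2) = (\<Sum>r\<in>R. (L (\<phi> n r))\<^sup>2)" if n: "n \<in> P" for n
  proof -
    have "(\<Sum>j\<in>J n. (L (u j))\<^sup>2) = (\<Sum>j\<in>J n. \<Sum>r\<in>R. L (\<phi> n r) * (\<alpha> n j r * L (u j)))"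
      by (rule sum.cong) (auto simp: power2_eq_square L_u[OF n] sum_distrib_left sum_distrib_right algebra_simps)
    also have "\<dots> = (\<Sum>r\<in>R. L (\<phi> n r) * (\<Sum>j\<in>J n. \<alpha> n j r * L (u j)))"
      by (subst sum.swap) (simp add: sum_distrib_left)
    also have "\<dots> = (\<Sum>r\<in>R. (L (\<phi> n r))\<^sup>2)"
      by (rule sum.cong) (auto simp: power2_eq_square L_\<phi>[OF n])
    finally show ?thesis .
  qed
  \<comment> \<open>All terms are nonnegative, so the series may be treated as an unordered sum; the
    order in which the eigensystem lists its eigenvalues then becomes irrelevant.\<close>
  have "((\<lambda>n. if 0 < \<kappa> n then \<kappa> n * (\<Sum>r\<in>R. (L (\<phi> n r))\<^sup>2) else 0) has_sum S) UNIV"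
    using S unfolding L_def by (rule sums_nonneg_imp_has_sum) (simp add: sum_nonneg)
  then have P_sum: "((\<lambda>n. \<kappa> n * (\<Sum>r\<in>R. (L (\<phi> n r))\<^sup>2)) has_sum S) P"
    by (rule has_sum_cong_neutral[THEN iffD1, rotated -1]) (auto simp: P_def)
  let ?f = "\<lambda>(n, j). lam j * (L (u j))\<^sup>2"
  have inner: "((\<lambda>j. ?f (n, j)) has_sum \<kappa> n * (\<Sum>r\<in>R. (L (\<phi> n r))\<^sup>2)) (J n)" if n: "n \<in> P" for n
  proof -
    have "(\<Sum>j\<in>J n. lam j * (L (u j))\<^sup>2) = \<kappa> n * (\<Sum>r\<in>R. (L (\<phi> n r))\<^sup>2)"
      by (simp add: block[OF n, symmetric] sum_distrib_left J_def)
    then show ?thesis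
      using has_sum_finite[OF J_finite[OF n], of "\<lambda>j. lam j * (L (u j))\<^sup>2"] by simp
  qed
  have Sigma_sum: "(?f has_sum S) (Sigma P J)"
  proof (rule has_sum_SigmaI[OF inner P_sum])
    show "?f summable_on Sigma P J"
    proof (rule summable_on_SigmaI[OF inner])
      show "(\<lambda>n. \<kappa> n * (\<Sum>r\<in>R. (L (\<phi> n r))\<^sup>2)) summable_on P"
        using P_sum by (auto simp: summable_on_def)
      show "0 \<le> ?f (n, j)" if "j \<in> J n" for n j
        using lam_pos[of j] that by (simp add: J_def)
    qed
  qed
  \<comment> \<open>An index in no block would have an eigenvalue outside the range of
    \<open>\<kappa>\<close>; its eigenfunction would vanish almost everywhere, against its norm
    1.\<close>
  have "\<exists>n. n \<in> P \<and> j \<in> J n" if j: "enat j < N" for j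
  proof (rule ccontr)
    assume none: "\<not> ?thesis"
    have "lam j \<notin> range \<kappa>"
    proof
      assume "lam j \<in> range \<kappa>"
      then obtain n where "lam j = \<kappa> n" by auto
      then show False
        using none j lam_pos[OF j] by (auto simp: P_def J_def)
    qed
    then have "AE z in \<mu>. u j z = 0"
      using eigenvalue_in_range[OF u_eig[OF j]] lam_pos[OF j] by simp
    then have "AE z in \<mu>. u j z * u j z = 0"
      by eventually_elim simp
    then have "(\<integral>z. u j z * u j z \<partial>\<mu>) = 0"
      by (rule integral_eq_zero_AE)
    then show False
      using u_ortho[OF j j] by simp
  qed
  then have "bij_betw snd (Sigma P J) {j. enat j < N}"
    using inj_\<kappa> by (auto simp: bij_betw_def inj_on_def J_def image_iff dest: injD) force
  from has_sum_reindex_bij_betw[OF this, of "\<lambda>j. lam j * (L (u j))\<^sup>2" S] Sigma_sum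
  have "((\<lambda>j. lam j * (L (u j))\<^sup>2) has_sum S) {j. enat j < N}"
    by (simp add: case_prod_unfold)
  then have "((\<lambda>j. if enat j < N then lam j * (L (u j))\<^sup>2 else 0) has_sum S) UNIV"
    by (rule has_sum_cong_neutral[THEN iffD1, rotated -1]) auto
  then show ?thesis
    unfolding L_def by (rule has_sum_imp_sums)
qed

end

section \<open>The series of cosines over squares\<close>

lemma summable_inverse_squares_Suc: "summable (\<lambda>n. 1 / (real (Suc n))\<^sup>2)"
  using inverse_squares_sums by (simp add: sums_iff add.commute)

text \<open>The imaginary part of \<open>- Ln (1 - z) = z + z^2/2 + z^3/3 + ...\<close> at
  \<open>z = r * cis t\<close>.\<close>

lemma sums_sin_power_series:
  assumes "0 \<le> r" "r < 1"
  shows "(\<lambda>n. r ^ Suc n * sin (real (Suc n) * t) / real (Suc n)) sums - Im (Ln (1 - of_real r * cis t))"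
proof -
  have "cmod (- (of_real r * cis t)) < 1"
    using assms by (simp add: norm_mult)
  from Ln_series'[OF this]
  have "(\<lambda>n. - ((of_real r * cis t) ^ n) / of_nat n) sums Ln (1 - of_real r * cis t)"
    by simp
  then have "(\<lambda>n. - Im (- ((of_real r * cis t) ^ n) / of_nat n)) sums - Im (Ln (1 - of_real r * cis t))"
    by (intro sums_minus sums_Im)
  moreover have "- Im (- ((of_real r * cis t) ^ n) / of_nat n) = r ^ n * sin (real n * t) / real n" for n
  proof -
    have "(of_real r * cis t) ^ n / of_nat n = of_real (r ^ n / real n) * cis (real n * t)"
      by (simp only: power_mult_distrib Complex.DeMoivre of_real_divide of_real_power of_real_of_nat_eq
          times_divide_eq_left)
    then show ?thesis
      by (simp only: minus_divide_left[symmetric] uminus_complex.sel minus_minus) simp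
  qed
  ultimately have "(\<lambda>n. r ^ n * sin (real n * t) / real n) sums - Im (Ln (1 - of_real r * cis t))"
    by (simp only:)
  \<comment> \<open>The term with index 0 is 0 because division by 0 gives 0, so the index may be
    shifted.\<close>
  then show ?thesis
    using sums_Suc_iff[of "\<lambda>n. r ^ n * sin (real n * t) / real n"] by simp
qed

text \<open>The damping by \<open>r < 1\<close> lets a geometric series dominate the derivatives;
  the undamped series of \<open>sin (n t) / n\<close> does not converge uniformly near 0.\<close>

lemma has_real_derivative_cos_power_series:
  assumes "0 \<le> r" "r < 1"
  shows "((\<lambda>t. \<Sum>n. r ^ Suc n * cos (real (Suc n) * t) / (real (Suc n))\<^sup>2) has_real_derivative
    Im (Ln (1 - of_real r * cis t))) (at t)"
proof -
  let ?f = "\<lambda>n t. r ^ Suc n * cos (real (Suc n) * t) / (real (Suc n))\<^sup>2"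
  let ?f' = "\<lambda>n t. - (r ^ Suc n * sin (real (Suc n) * t) / real (Suc n))"
  have "((\<lambda>t. \<Sum>n. ?f n t) has_field_derivative (\<Sum>n. ?f' n t)) (at t)"
  proof (rule has_field_derivative_series'(2)[where S = UNIV and x0 = t])
    show "(?f n has_field_derivative ?f' n s) (at s within UNIV)" for n s
      by (rule derivative_eq_intros refl | simp add: power2_eq_square)+
    show "uniformly_convergent_on UNIV (\<lambda>n t. \<Sum>i<n. ?f' i t)"
    proof (rule Weierstrass_m_test')
      have "r ^ Suc n * \<bar>sin x\<bar> / real (Suc n) \<le> r ^ Suc n" for n x
      proof -
        have "r ^ Suc n * (\<bar>sin x\<bar> / real (Suc n)) \<le> r ^ Suc n * 1"
          using assms order_trans[OF abs_sin_le_one[of x], of "real (Suc n)"]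
          by (intro mult_left_mono) (auto simp: divide_simps)
        then show ?thesis by simp
      qed
      then show "norm (?f' n s) \<le> r ^ Suc n" for n s
        using assms by (simp add: abs_mult)
      show "summable (\<lambda>n. r ^ Suc n)"
        using assms by (subst summable_Suc_iff) (simp add: summable_geometric)
    qed
    show "summable (\<lambda>n. ?f n t)"
    proof (rule summable_comparison_test)
      show "summable (\<lambda>n. r ^ Suc n)"
        using assms by (subst summable_Suc_iff) (simp add: summable_geometric)
      have "\<bar>?f n t\<bar> \<le> r ^ Suc n" for n
      proof -
        have "\<bar>?f n t\<bar> = r ^ Suc n * (\<bar>cos (real (Suc n) * t)\<bar> / (real (Suc n))\<^sup>2)"
          using assms by (simp add: abs_mult)
        also have "\<dots> \<le> r ^ Suc n * 1"
          using assms order_trans[OF abs_cos_le_one[of "real (Suc n) * t"] one_le_power[of "real (Suc n)" 2]]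
          by (intro mult_left_mono) (auto simp: divide_simps simp del: of_nat_Suc)
        finally show ?thesis by simp
      qed
      then show "\<exists>N. \<forall>n\<ge>N. norm (?f n t) \<le> r ^ Suc n" by auto
    qed
  qed auto
  also have "(\<Sum>n. ?f' n t) = Im (Ln (1 - of_real r * cis t))"
    using sums_minus[OF sums_sin_power_series[OF assms, of t]] by (simp add: sums_iff)
  finally show ?thesis .
qed

text \<open>Polar form: \<open>1 - cis t\<close> is \<open>2 * sin (t / 2)\<close>, a positive
  number, times \<open>cis ((t - pi) / 2)\<close>, and this angle lies in the principal
  range.\<close>

lemma Im_Ln_one_minus_cis:
  assumes "0 < t" "t < 2 * pi"
  shows "Im (Ln (1 - cis t)) = (t - pi) / 2"
proof -
  have "1 - cis t = of_real (2 * sin (t / 2)) * cis ((t - pi) / 2)"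
  proof (rule complex_eqI)
    have c: "cos ((t - pi) / 2) = sin (t / 2)" "sin ((t - pi) / 2) = - cos (t / 2)"
      by (simp_all add: diff_divide_distrib cos_diff sin_diff)
    have *: "cos t = 1 - 2 * (sin (t / 2))\<^sup>2" "sin t = 2 * sin (t / 2) * cos (t / 2)"
      using cos_double_sin[of "t / 2"] sin_double[of "t / 2"] by simp_all
    show "Re (1 - cis t) = Re (of_real (2 * sin (t / 2)) * cis ((t - pi) / 2))"
      using * c by (simp add: power2_eq_square)
    show "Im (1 - cis t) = Im (of_real (2 * sin (t / 2)) * cis ((t - pi) / 2))"
      using * c by simp
  qed
  moreover have "sin (t / 2) > 0"
    using assms by (intro sin_gt_zero) auto
  moreover have "(t - pi) / 2 \<in> {-pi<..pi}"
    using assms by auto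
  ultimately have "Arg (1 - cis t) = (t - pi) / 2"
    using Arg_times_of_real[of "2 * sin (t / 2)" "cis ((t - pi) / 2)"] Arg_cis by simp
  moreover have "1 - cis t \<noteq> 0"
    using \<open>1 - cis t = _\<close> \<open>sin (t / 2) > 0\<close> by auto
  ultimately show ?thesis
    by (simp add: Arg_eq_Im_Ln)
qed

text \<open>This carries the closed form to the endpoints 0 and \<open>2 * pi\<close>, where
  \<open>1 - cis t\<close> vanishes and its logarithm gives no information.\<close>

lemma continuous_on_cos_series:
  "continuous_on UNIV (\<lambda>t. \<Sum>n. cos (real (Suc n) * t) / (real (Suc n))\<^sup>2)"
proof (rule uniform_limit_theorem)
  show "uniform_limit UNIV (\<lambda>n t. \<Sum>i<n. cos (real (Suc i) * t) / (real (Suc i))\<^sup>2)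
      (\<lambda>t. \<Sum>n. cos (real (Suc n) * t) / (real (Suc n))\<^sup>2) sequentially"
    by (rule Weierstrass_m_test[OF _ summable_inverse_squares_Suc])
       (auto simp: divide_simps simp del: of_nat_Suc)
  show "\<forall>\<^sub>F n in sequentially. continuous_on UNIV (\<lambda>t. \<Sum>i<n. cos (real (Suc i) * t) / (real (Suc i))\<^sup>2)"
    by (intro always_eventually allI continuous_intros) auto
qed simp

lemma summable_cos_series: "summable (\<lambda>n. cos (real (Suc n) * t) / (real (Suc n))\<^sup>2)"
  by (rule summable_comparison_test'[OF summable_inverse_squares_Suc, of 0])
     (auto simp: divide_simps simp del: of_nat_Suc)

text \<open>Abel summation: the increments of the series damped by \<open>r ^ Suc n\<close> are integrals of the
  bounded function \<open>Im (Ln (1 - r e\<^sup>i\<^sup>t))\<close>, and \<open>r\<close> tends to 1.\<close>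

lemma cos_series_diff:
  assumes "0 < s" "s \<le> t" "t < 2 * pi"
  shows "(\<Sum>n. cos (real (Suc n) * t) / (real (Suc n))\<^sup>2) - (\<Sum>n. cos (real (Suc n) * s) / (real (Suc n))\<^sup>2)
    = ((t - pi)\<^sup>2 - (s - pi)\<^sup>2) / 4"
proof -
  define r where "r k = 1 - 1 / real (Suc k)" for k
  define F where "F k x = (\<Sum>n. r k ^ Suc n * cos (real (Suc n) * x) / (real (Suc n))\<^sup>2)" for k x
  have r: "0 \<le> r k" "r k < 1" for k
    by (auto simp: r_def)
  have r_lim: "r \<longlonglongrightarrow> 1"
    unfolding r_def using tendsto_diff[OF tendsto_const LIMSEQ_Suc[OF lim_1_over_n]] by simp
  have F_lim: "(\<lambda>k. F k x) \<longlonglongrightarrow> (\<Sum>n. cos (real (Suc n) * x) / (real (Suc n))\<^sup>2)" for x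
    unfolding F_def
  proof (rule tannerys_theorem[THEN conjunct2, THEN conjunct2])
    show "(\<lambda>k. r k ^ Suc n * cos (real (Suc n) * x) / (real (Suc n))\<^sup>2) \<longlonglongrightarrow>
        cos (real (Suc n) * x) / (real (Suc n))\<^sup>2" for n
      by (rule tendsto_eq_intros r_lim refl | simp)+
    have "norm (r k ^ Suc n * cos (real (Suc n) * x) / (real (Suc n))\<^sup>2) \<le> 1 / (real (Suc n))\<^sup>2" for n k
    proof -
      have "\<bar>r k\<bar> ^ Suc n * \<bar>cos (real (Suc n) * x)\<bar> \<le> 1 * 1"
        using r[of k] by (intro mult_mono power_le_one) auto
      then show ?thesis
        by (simp add: abs_mult power_abs divide_right_mono del: power_Suc of_nat_Suc)
    qed
    then show "\<forall>\<^sub>F (n, k) in at_top \<times>\<^sub>F sequentially.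
        norm (r k ^ Suc n * cos (real (Suc n) * x) / (real (Suc n))\<^sup>2) \<le> 1 / (real (Suc n))\<^sup>2"
      by (intro always_eventually) auto
  qed (use summable_inverse_squares_Suc in auto)
  define g where "g k x = Im (Ln (1 - of_real (r k) * cis x))" for k x
  have g_int: "(g k has_integral F k t - F k s) {s..t}" for k
    unfolding F_def g_def using assms(2)
    by (intro fundamental_theorem_of_calculus has_field_derivative_at_within
        has_real_derivative_cos_power_series[unfolded has_real_derivative_iff_has_vector_derivative]
        has_vector_derivative_at_within r)
  have "((\<lambda>x. (x - pi) / 2) has_integral ((t - pi)\<^sup>2 / 4 - (s - pi)\<^sup>2 / 4)) {s..t}"
    using assms(2)
    by (intro fundamental_theorem_of_calculus)
       (auto intro!: derivative_eq_intros simp: has_real_derivative_iff_has_vector_derivative[symmetric])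
  then have int: "integral {s..t} (\<lambda>x. (x - pi) / 2) = ((t - pi)\<^sup>2 - (s - pi)\<^sup>2) / 4"
    by (simp add: integral_unique diff_divide_distrib)
  have "(\<lambda>k. integral {s..t} (g k)) \<longlonglongrightarrow> integral {s..t} (\<lambda>x. (x - pi) / 2)"
  proof (rule dominated_convergence(2))
    show "g k integrable_on {s..t}" for k
      using g_int by blast
    show "(\<lambda>x. pi) integrable_on {s..t}"
      by (rule integrable_const_ivl)
    \<comment> \<open>In the right half-plane the argument is bounded, which provides the constant
      dominating function.\<close>
    have re: "0 < Re (1 - of_real (r k) * cis x)" for k x
    proof -
      have "r k * cos x \<le> r k * 1"
        using r by (intro mult_left_mono) auto
      then show ?thesis
        using r(2)[of k] by simp
    qed
    show "norm (g k x) \<le> pi" for k x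
      using Re_Ln_pos_lt_imp[OF re, of k x] pi_gt_zero by (simp add: g_def)
    show "(\<lambda>k. g k x) \<longlonglongrightarrow> (x - pi) / 2" if x: "x \<in> {s..t}" for x
    proof -
      have x': "0 < x" "x < 2 * pi"
        using x assms by auto
      \<comment> \<open>The limit point \<open>1 - cis x\<close> stays off the branch cut, so
        \<open>Ln\<close> is continuous there.\<close>
      have "cos x \<noteq> 1"
        using x' cos_one_2pi_int[of x] by (auto simp: mult_less_cancel_right1 zero_less_mult_iff) 
      then have "cos x < 1"
        using cos_le_one[of x] by linarith
      then have nonpos: "1 - cis x \<notin> \<real>\<^sub>\<le>\<^sub>0"
        by (auto simp: complex_nonpos_Reals_iff)
      have "(\<lambda>k. 1 - of_real (r k) * cis x) \<longlonglongrightarrow> 1 - of_real 1 * cis x"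
        by (intro tendsto_intros r_lim)
      then have "(\<lambda>k. g k x) \<longlonglongrightarrow> Im (Ln (1 - cis x))"
        unfolding g_def using nonpos by (intro tendsto_Im tendsto_Ln) auto
      then show ?thesis
        by (simp add: Im_Ln_one_minus_cis x')
    qed
  qed
  then have "(\<lambda>k. F k t - F k s) \<longlonglongrightarrow> ((t - pi)\<^sup>2 - (s - pi)\<^sup>2) / 4"
    unfolding integral_unique[OF g_int] int .
  then show ?thesis
    using LIMSEQ_unique tendsto_diff[OF F_lim F_lim] by blast
qed

lemma sums_cos_over_squares:
  assumes "0 \<le> t" "t \<le> 2 * pi"
  shows "(\<lambda>n. cos (real (Suc n) * t) / (real (Suc n))\<^sup>2) sums (pi\<^sup>2 / 6 - pi * t / 2 + t\<^sup>2 / 4)"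
proof -
  define F where "F t = (\<Sum>n. cos (real (Suc n) * t) / (real (Suc n))\<^sup>2)" for t
  \<comment> \<open>The increments of the series are those of the parabola, so \<open>D\<close> is
    constant on the open interval, and by continuity on the closed one. At 0 the sum of the inverse
    squares fixes the constant.\<close>
  define D where "D t = F t - (t - pi)\<^sup>2 / 4" for t
  have D_cont: "continuous_on {0..2*pi} D"
    unfolding D_def F_def
    by (intro continuous_intros continuous_on_subset[OF continuous_on_cos_series]) auto
  have D_const: "D t = D pi" if "t \<in> {0..2*pi}" for t
  proof (rule continuous_constant_on_closure[of "{0<..<2*pi}" D "D pi" t])
    show "continuous_on (closure {0<..<2*pi}) D"
      using D_cont by simp
    have F_diff: "F b - F a = ((b - pi)\<^sup>2 - (a - pi)\<^sup>2) / 4" if "0 < a" "a \<le> b" "b < 2 * pi" for a b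
      unfolding F_def using that by (rule cos_series_diff)
    show "D s = D pi" if "s \<in> {0<..<2*pi}" for s
    proof (cases "s \<le> pi")
      case True
      with F_diff[of s pi] that show ?thesis by (simp add: D_def)
    next
      case False
      with F_diff[of pi s] that show ?thesis by (simp add: D_def)
    qed
    show "t \<in> closure {0<..<2*pi}"
      using that by simp
  qed
  have "D t = D 0"
    using D_const[of t] D_const[of 0] assms by simp
  moreover have "F 0 = pi\<^sup>2 / 6"
    using inverse_squares_sums by (simp add: F_def sums_iff add.commute)
  ultimately have "F t = pi\<^sup>2 / 6 - pi * t / 2 + t\<^sup>2 / 4"
    by (simp add: D_def power2_diff diff_divide_distrib add_divide_distrib)
  then show ?thesis
    using summable_cos_series[of t] by (simp add: sums_iff F_def)
qed

section \<open>The geodesic distance of the circle\<close>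

lemma circle_representation:
  assumes "x \<in> circle" "y \<in> circle"
  obtains a t where "x = cis a" "y = cis (a + t)" "\<bar>t\<bar> \<le> pi"
proof
  show x: "x = cis (Arg x)"
    using assms rcis_cmod_Arg[of x] by (simp add: rcis_def)
  have "y / x = cis (Arg (y / x))"
    using assms rcis_cmod_Arg[of "y / x"] by (simp add: rcis_def norm_divide)
  then show "y = cis (Arg x + Arg (y / x))"
    using assms x by (metis cis_mult nonzero_mult_div_cancel_left norm_zero mem_sphere_0
        times_divide_eq_right zero_neq_one)
  show "\<bar>Arg (y / x)\<bar> \<le> pi"
    using Arg_bounded[of "y / x"] by auto
qed

abbreviation circle_curve :: "complex \<Rightarrow> complex \<Rightarrow> (real \<Rightarrow> complex) \<Rightarrow> bool" where
  "circle_curve x y g \<equiv> g C1_differentiable_on {0..1} \<and> g ` {0..1} \<subseteq> circle \<and> g 0 = x \<and> g 1 = y"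

text \<open>The integral \<open>w\<close> of \<open>g' / g\<close> is a logarithm of
  \<open>g 1 / g 0\<close>, so \<open>Im w\<close> is the total angle swept by the curve; as
  \<open>g\<close> has modulus 1, the length bounds \<open>norm w\<close>.\<close>

lemma circle_curve_length_ge:
  assumes "circle_curve (cis a) (cis (a + t)) g" "\<bar>t\<bar> \<le> pi"
  shows "\<bar>t\<bar> \<le> integral {0..1} (\<lambda>s. norm (vector_derivative g (at s)))"
proof -
  have g: "g C1_differentiable_on {0..1}" "g ` {0..1} \<subseteq> circle" "g 0 = cis a" "g 1 = cis (a + t)"
    using assms by auto
  have norm_g: "norm (g s) = 1" if "s \<in> {0..1}" for s
    using g(2) that by (auto simp: image_subset_iff)
  let ?v = "\<lambda>s. vector_derivative g (at s)"
  define w where "w = integral {0..1} (\<lambda>s. ?v s / (g s - 0))"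
  have pw: "g piecewise_C1_differentiable_on {0..1}"
    by (simp add: C1_differentiable_imp_piecewise g(1))
  have no0: "0 \<notin> g ` {0..1}"
    using norm_g by force
  have int: "(\<lambda>s. ?v s / (g s - 0)) integrable_on {0..1}"
    and "exp (- w) * (g 1 - 0) = g 0 - 0"
    unfolding w_def using winding_number_exp_integral[OF pw _ no0] by auto
  then have exp_w: "exp w = cis t"
    by (auto simp: g exp_minus cis_mult[symmetric] field_simps)
  \<comment> \<open>\<open>Im w\<close> is determined up to multiples of \<open>2 * pi\<close>, and
    \<open>\<bar>t\<bar> \<le> pi\<close> makes \<open>t\<close> smallest in absolute value among
    the candidates.\<close>
  have "\<bar>t\<bar> \<le> \<bar>Im w\<bar>"
  proof -
    from exp_w have "exp w = exp (\<i> * of_real t)"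
      by (simp add: cis_conv_exp)
    then obtain n :: int where "w = \<i> * of_real t + of_real (of_int (2 * n) * pi) * \<i>"
      unfolding exp_eq by blast
    then have n: "Im w = t + of_int n * (2 * pi)"
      by simp
    show ?thesis
    proof (cases "n = 0")
      case False
      then have "1 \<le> \<bar>real_of_int n\<bar>"
        by linarith
      then have "2 * pi \<le> \<bar>of_int n * (2 * pi)\<bar>"
        by (simp add: abs_mult)
      then show ?thesis
        using n assms(2) by linarith
    qed (use n in simp)
  qed
  also have "\<bar>Im w\<bar> \<le> norm w"
    by (rule abs_Im_le_cmod)
  also have "norm w \<le> integral {0..1} (\<lambda>s. norm (?v s))"
    unfolding w_def
  proof (rule integral_norm_bound_integral[OF int])
    show "(\<lambda>s. norm (?v s)) integrable_on {0..1}"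
      using g(1) unfolding C1_differentiable_on_eq
      by (intro integrable_continuous_interval continuous_on_norm) auto
    show "norm (?v s / (g s - 0)) \<le> norm (?v s)" if "s \<in> {0..1}" for s
      using norm_g[OF that] by (simp add: norm_divide)
  qed
  finally show ?thesis .
qed

lemma arc_circle_curve:
  "circle_curve (cis a) (cis (a + t)) (\<lambda>s. cis (a + s * t))"
  "integral {0..1} (\<lambda>s. norm (vector_derivative (\<lambda>s. cis (a + s * t)) (at s))) = \<bar>t\<bar>"
proof -
  have D: "((\<lambda>s. cis (a + s * t)) has_vector_derivative (\<i> * of_real t * cis (a + s * t))) (at s)" for s
    unfolding cis_conv_exp
    by (rule derivative_eq_intros has_vector_derivative_real_field refl | simp)+
  show "circle_curve (cis a) (cis (a + t)) (\<lambda>s. cis (a + s * t))"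
    unfolding C1_differentiable_on_def using D
    by (auto intro!: exI[of _ "\<lambda>s. \<i> * of_real t * cis (a + s * t)"] continuous_intros)
  show "integral {0..1} (\<lambda>s. norm (vector_derivative (\<lambda>s. cis (a + s * t)) (at s))) = \<bar>t\<bar>"
    by (simp add: vector_derivative_at[OF D] norm_mult)
qed

lemma circle_dist_cis:
  assumes "\<bar>t\<bar> \<le> pi"
  shows "circle_dist (cis a) (cis (a + t)) = \<bar>t\<bar>"
  unfolding circle_dist_def
proof (rule cInf_eq_minimum)
  show "\<bar>t\<bar> \<in> {integral {0..1} (\<lambda>s. norm (vector_derivative g (at s))) |g. circle_curve (cis a) (cis (a + t)) g}"
    unfolding mem_Collect_eq
    by (rule exI, rule conjI, rule arc_circle_curve(2)[symmetric], rule arc_circle_curve(1))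
qed (use circle_curve_length_ge[OF _ assms] in blast)

text \<open>Arcs longer than \<open>pi\<close> are included: in the triangle inequality the angles
  of two shortest arcs may add up to more than \<open>pi\<close>.\<close>

lemma circle_dist_cis_le: "circle_dist (cis a) (cis (a + t)) \<le> \<bar>t\<bar>"
  unfolding circle_dist_def
proof (rule cInf_lower)
  show "bdd_below {integral {0..1} (\<lambda>s. norm (vector_derivative g (at s))) |g. circle_curve (cis a) (cis (a + t)) g}"
    by (rule bdd_belowI[of _ 0])
       (auto intro!: integral_nonneg integrable_continuous_interval continuous_on_norm
         simp: C1_differentiable_on_eq)
  show "\<bar>t\<bar> \<in> {integral {0..1} (\<lambda>s. norm (vector_derivative g (at s))) |g. circle_curve (cis a) (cis (a + t)) g}"
    unfolding mem_Collect_eq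
    by (rule exI, rule conjI, rule arc_circle_curve(2)[symmetric], rule arc_circle_curve(1))
qed

lemma circle_dist_cases:
  assumes "x \<in> circle" "y \<in> circle"
  obtains a t where "x = cis a" "y = cis (a + t)" "\<bar>t\<bar> \<le> pi" "circle_dist x y = \<bar>t\<bar>"
  using circle_representation[OF assms] circle_dist_cis by metis

text \<open>\<open>Metric_space\<close> demands symmetry for all arguments, also off the carrier;
  there both orders give the infimum of the empty set.\<close>

lemma circle_dist_outside:
  assumes "\<not> (x \<in> circle \<and> y \<in> circle)"
  shows "circle_dist x y = Inf {}"
proof -
  have "{integral {0..1} (\<lambda>t. norm (vector_derivative g (at t))) |g. circle_curve x y g} = {}"
  proof -
    have "\<not> circle_curve x y g" for g
    proof
      assume g: "circle_curve x y g"
      then have "g 0 \<in> circle" "g 1 \<in> circle"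
        by (meson atLeastAtMost_iff image_subset_iff order_refl zero_le_one)+
      with g assms show False by simp
    qed
    then show ?thesis by blast
  qed
  then show ?thesis
    unfolding circle_dist_def by (rule arg_cong)
qed

lemma circle_dist_nonneg: "x \<in> circle \<Longrightarrow> y \<in> circle \<Longrightarrow> 0 \<le> circle_dist x y"
  by (metis circle_dist_cases abs_ge_zero)

lemma circle_dist_le_pi: "x \<in> circle \<Longrightarrow> y \<in> circle \<Longrightarrow> circle_dist x y \<le> pi"
  by (metis circle_dist_cases)

lemma circle_dist_commute: "circle_dist x y = circle_dist y x"
proof (cases "x \<in> circle \<and> y \<in> circle")
  case True
  then obtain a t where "x = cis a" "y = cis (a + t)" "\<bar>t\<bar> \<le> pi" "circle_dist x y = \<bar>t\<bar>"
    using circle_dist_cases by blast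
  then show ?thesis
    using circle_dist_cis[of "- t" "a + t"] by simp
next
  case False
  then show ?thesis
    using circle_dist_outside[of x y] circle_dist_outside[of y x] by metis
qed

text \<open>The chord of an arc of angle \<open>t\<close> has length
  \<open>2 * \<bar>sin (t / 2)\<bar>\<close>. The comparison separates points and transfers
  Lipschitz bounds to the geodesic distance.\<close>

lemma dist_le_circle_dist:
  assumes "x \<in> circle" "y \<in> circle"
  shows "dist x y \<le> circle_dist x y"
proof -
  obtain a t where *: "x = cis a" "y = cis (a + t)" "circle_dist x y = \<bar>t\<bar>"
    using circle_dist_cases[OF assms] by metis
  have "dist x y = norm (cis a * (1 - cis t))"
    by (simp add: * dist_norm cis_mult algebra_simps)
  also have "\<dots> = norm (1 - cis t)"
    by (simp add: norm_mult)
  also have "\<dots> \<le> \<bar>t\<bar>"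
  proof (rule power2_le_imp_le)
    have "(norm (1 - cis t))\<^sup>2 = (1 - cos t)\<^sup>2 + (sin t)\<^sup>2"
      by (simp add: cmod_power2)
    also have "\<dots> = 2 - 2 * cos t"
      using sin_cos_squared_add[of t] by (simp add: power2_diff)
    also have "\<dots> = 4 * (sin (t / 2))\<^sup>2"
      using cos_double_sin[of "t / 2"] by simp
    also have "\<dots> \<le> 4 * (t / 2)\<^sup>2"
      using abs_sin_x_le_abs_x[of "t / 2"] by (intro mult_left_mono) (simp_all only: abs_le_square_iff zero_le_numeral)
    finally show "(norm (1 - cis t))\<^sup>2 \<le> \<bar>t\<bar>\<^sup>2"
      by (simp add: power_divide)
  qed simp
  finally show ?thesis
    using *(3) by simp
qed

text \<open>Off the circle \<open>circle_dist\<close> is the unspecified value \<open>Inf {}\<close>, whose sign is not known.\<close>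

lemma Metric_space_circle: "Metric_space circle (\<lambda>x y. \<bar>circle_dist x y\<bar>)"
proof
  fix x y z assume xyz: "x \<in> circle" "y \<in> circle" "z \<in> circle"
  show "\<bar>circle_dist x y\<bar> = 0 \<longleftrightarrow> x = y"
    using dist_le_circle_dist[OF xyz(1,2)] circle_dist_cases[OF xyz(1,2)]
    by (metis abs_eq_0 add_0_right dist_le_zero_iff circle_dist_cis pi_ge_zero abs_zero)
  obtain a s where s: "x = cis a" "y = cis (a + s)" "circle_dist x y = \<bar>s\<bar>"
    using circle_dist_cases[OF xyz(1,2)] by metis
  obtain b t where t: "y = cis b" "z = cis (b + t)" "circle_dist y z = \<bar>t\<bar>"
    using circle_dist_cases[OF xyz(2,3)] by metis
  have "z = cis (a + (s + t))"
    using s t by (metis add.assoc cis_mult)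
  then have "circle_dist x z \<le> \<bar>s + t\<bar>"
    using s circle_dist_cis_le by simp
  then show "\<bar>circle_dist x z\<bar> \<le> \<bar>circle_dist x y\<bar> + \<bar>circle_dist y z\<bar>"
    using s t circle_dist_nonneg[OF xyz(1,3)] by simp
qed (auto simp: circle_dist_commute)

lemma Metric_space_torus: "Metric_space flat_torus torus_dist"
proof -
  interpret Metric_space12 circle "\<lambda>x y. \<bar>circle_dist x y\<bar>" circle "\<lambda>x y. \<bar>circle_dist x y\<bar>"
    by (intro Metric_space12.intro Metric_space_circle)
  \<comment> \<open>The squares in \<open>prod_dist\<close> absorb the absolute values.\<close>
  have "torus_dist = prod_dist (\<lambda>x y. \<bar>circle_dist x y\<bar>) (\<lambda>x y. \<bar>circle_dist x y\<bar>)"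
    by (intro ext) (simp add: torus_dist_def prod_dist_def case_prod_unfold)
  then show ?thesis
    using prod_metric by (simp add: flat_torus_def)
qed

section \<open>The flat torus\<close>

lemma cis_measurable: "cis \<in> measurable (uniform_measure lborel {0..<2*pi}) (restrict_space borel circle)"
proof (rule measurable_restrict_space2)
  have "cis \<in> borel_measurable borel"
    by (intro borel_measurable_continuous_onI continuous_intros)
  then show "cis \<in> borel_measurable (uniform_measure lborel {0..<2*pi})"
    by simp
qed auto

lemma sets_circle_measure [measurable_cong]: "sets circle_measure = sets (restrict_space borel circle)"
  by (simp add: circle_measure_def)

lemma space_circle_measure [simp]: "space circle_measure = circle"
  by (simp add: circle_measure_def space_restrict_space)

lemma space_torus_measure [simp]: "space torus_measure = flat_torus"
  by (simp add: torus_measure_def flat_torus_def space_pair_measure)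

lemma prob_space_circle: "prob_space circle_measure"
  unfolding circle_measure_def
  by (intro prob_space.prob_space_distr prob_space_uniform_measure cis_measurable) auto

interpretation circle: prob_space circle_measure
  by (rule prob_space_circle)

interpretation torus: pair_prob_space circle_measure circle_measure ..

lemma prob_space_torus: "prob_space torus_measure"
  unfolding torus_measure_def by (rule torus.prob_space_axioms)

text \<open>The fundamental theorem of calculus provides integrals over the closed interval; it
  differs from the half-open parameter interval of the measure by a null point.\<close>

lemma has_bochner_integral_circle:
  fixes f :: "complex \<Rightarrow> real"
  assumes [measurable]: "f \<in> borel_measurable circle_measure"
    and f: "has_bochner_integral lborel (\<lambda>t. f (cis t) * indicator {0..2*pi} t) v"
  shows "(\<integral>z. f z \<partial>circle_measure) = v / (2 * pi)"
proof -
  have [measurable]: "(\<lambda>t. f (cis t)) \<in> borel_measurable lborel"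
    using measurable_compose[OF cis_measurable, of f borel] assms(1)
    by (simp add: measurable_cong_sets[OF sets_circle_measure refl])
  have dens: "uniform_measure lborel {0..<2*pi} =
      density lborel (\<lambda>t. ennreal (indicator {0..<2*pi} t / (2 * pi)))"
    unfolding uniform_measure_def
    by (rule arg_cong[where f = "density lborel"])
       (auto simp: fun_eq_iff divide_ennreal indicator_def ennreal_1[symmetric] simp del: ennreal_1)
  have "(\<integral>z. f z \<partial>circle_measure) = (\<integral>t. f (cis t) \<partial>uniform_measure lborel {0..<2*pi})"
    unfolding circle_measure_def
    using assms(1) by (intro integral_distr cis_measurable) (simp add: circle_measure_def)
  also have "\<dots> = (\<integral>t. (indicator {0..<2*pi} t / (2 * pi)) * f (cis t) \<partial>lborel)"
    unfolding dens by (subst integral_real_density) auto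
  also have "\<dots> = (\<integral>t. (f (cis t) * indicator {0..2*pi} t) / (2 * pi) \<partial>lborel)"
  proof (rule integral_cong_AE)
    show "AE t in lborel. indicator {0..<2*pi} t / (2 * pi) * f (cis t) =
        f (cis t) * indicator {0..2*pi} t / (2 * pi)"
      using AE_lborel_singleton[of "2 * pi"] by eventually_elim (auto simp: indicator_def)
  qed measurable
  also have "\<dots> = v / (2 * pi)"
    using f by (simp add: has_bochner_integral_integral_eq)
  finally show ?thesis .
qed

text \<open>The phases \<open>0\<close> and \<open>pi/2\<close> give the cosine and the sine of frequency \<open>n\<close>.\<close>

definition circle_wave :: "nat \<Rightarrow> real \<Rightarrow> complex \<Rightarrow> real" where
  "circle_wave n c z = Re (cis (- c) * z ^ n)"

lemma circle_wave_cis: "circle_wave n c (cis t) = cos (real n * t - c)"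
  by (simp only: circle_wave_def Complex.DeMoivre cis_mult cis.sel) (simp add: algebra_simps)

lemma measurable_circle_wave [measurable]: "circle_wave n c \<in> borel_measurable circle_measure"
proof -
  have "circle_wave n c \<in> borel_measurable borel"
    unfolding circle_wave_def[abs_def] by (intro borel_measurable_continuous_onI continuous_intros)
  then show ?thesis
    unfolding measurable_cong_sets[OF sets_circle_measure refl] by (rule measurable_restrict_space1)
qed

lemma abs_circle_wave_le: "z \<in> circle \<Longrightarrow> \<bar>circle_wave n c z\<bar> \<le> 1"
  unfolding circle_wave_def by (rule order_trans[OF abs_Re_le_cmod]) (simp add: norm_mult norm_power)

lemma circle_wave_lipschitz:
  assumes "x \<in> circle" "y \<in> circle"
  shows "\<bar>circle_wave n c x - circle_wave n c y\<bar> \<le> real n * dist x y"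
proof -
  have "\<bar>circle_wave n c x - circle_wave n c y\<bar> = \<bar>Re (cis (- c) * (x ^ n - y ^ n))\<bar>"
    by (simp add: circle_wave_def right_diff_distrib)
  also have "\<dots> \<le> norm (x ^ n - y ^ n)"
    by (rule order_trans[OF abs_Re_le_cmod]) (simp add: norm_mult)
  also have "\<dots> \<le> real n * norm (x - y)"
    using assms by (intro norm_power_diff) auto
  finally show ?thesis
    by (simp add: dist_norm)
qed

section \<open>Orthogonality relations\<close>

lemma has_bochner_integral_cos_period:
  "has_bochner_integral lborel (\<lambda>t. cos (of_int k * t - c) * indicator {0..2*pi} t)
    (if k = 0 then 2 * pi * cos c else 0)"
proof (cases "k = 0")
  case True
  have "has_bochner_integral lborel (\<lambda>t. cos c * indicator {0..2*pi} t) (2 * pi * cos c - 0 * cos c)"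
    by (rule has_bochner_integral_FTC_Icc_real[where F = "\<lambda>t. t * cos c"])
       (auto intro!: derivative_eq_intros)
  then show ?thesis
    using True by simp
next
  case False
  have "has_bochner_integral lborel (\<lambda>t. cos (of_int k * t - c) * indicator {0..2*pi} t)
      (sin (of_int k * (2 * pi) - c) / of_int k - sin (of_int k * 0 - c) / of_int k)"
    using False
    by (intro has_bochner_integral_FTC_Icc_real[where F = "\<lambda>t. sin (of_int k * t - c) / of_int k"])
       (auto intro!: derivative_eq_intros continuous_intros)
  moreover have "sin (of_int k * (2 * pi) - c) = sin (- c)"
    using sin_int_2pin[of k] cos_int_2pin[of k] by (simp add: sin_diff mult.commute mult.left_commute)
  ultimately show ?thesis
    using False by simp
qed

lemma integral_circle_wave: "n \<noteq> 0 \<Longrightarrow> (\<integral>z. circle_wave n c z \<partial>circle_measure) = 0"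
  using has_bochner_integral_cos_period[of "int n" c]
  by (subst has_bochner_integral_circle[where v = 0]) (auto simp: circle_wave_cis)

text \<open>The product is half the sum of cosines of frequencies \<open>m - n\<close> and
  \<open>m + n\<close>. The first may be negative, hence the integer frequency in the period
  integral; the second is never 0.\<close>

lemma integral_circle_wave_mult:
  assumes "m \<noteq> 0" "n \<noteq> 0"
  shows "(\<integral>z. circle_wave m a z * circle_wave n b z \<partial>circle_measure) =
    (if m = n then cos (a - b) / 2 else 0)"
proof -
  have "has_bochner_integral lborel (\<lambda>t.
      cos (of_int (int m - int n) * t - (a - b)) * indicator {0..2*pi} t / 2 +
      cos (of_int (int m + int n) * t - (a + b)) * indicator {0..2*pi} t / 2)
      ((if int m - int n = 0 then 2 * pi * cos (a - b) else 0) / 2 +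
       (if int m + int n = 0 then 2 * pi * cos (a + b) else 0) / 2)"
    by (intro has_bochner_integral_add has_bochner_integral_divide has_bochner_integral_cos_period)
  moreover have "cos (of_int (int m - int n) * t - (a - b)) * indicator {0..2*pi} t / 2 +
      cos (of_int (int m + int n) * t - (a + b)) * indicator {0..2*pi} t / 2 =
      circle_wave m a (cis t) * circle_wave n b (cis t) * indicator {0..2*pi} t" for t
    by (simp add: circle_wave_cis cos_times_cos algebra_simps add_divide_distrib)
  ultimately have "has_bochner_integral lborel
      (\<lambda>t. circle_wave m a (cis t) * circle_wave n b (cis t) * indicator {0..2*pi} t)
      (if m = n then pi * cos (a - b) else 0)"
    using assms by (simp split: if_splits)
  then show ?thesis
    by (subst has_bochner_integral_circle) auto
qed

text \<open>Summing over both phases leaves a function of the difference \<open>t\<close> of the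
  angles, as a rotation-invariant kernel requires.\<close>

lemma circle_wave_mult_sum:
  "circle_wave n 0 (cis a) * circle_wave n 0 (cis (a + t)) +
   circle_wave n (pi/2) (cis a) * circle_wave n (pi/2) (cis (a + t)) = cos (real n * t)"
proof -
  have "cos (real n * t) = cos (real n * (a + t) - real n * a)"
    by (simp add: algebra_simps)
  then show ?thesis
    unfolding cos_diff by (simp add: circle_wave_cis cos_diff)
qed

text \<open>The index \<open>n\<close> stands for the frequency \<open>Suc n\<close>; the constants are excluded because \<open>P\<close> kills them.\<close>

definition torus_wave :: "nat \<Rightarrow> bool \<times> real \<Rightarrow> complex \<times> complex \<Rightarrow> real" where
  "torus_wave n r x = sqrt 2 * circle_wave (Suc n) (snd r) (if fst r then fst x else snd x)"

abbreviation torus_wave_index :: "(bool \<times> real) set" where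
  "torus_wave_index \<equiv> UNIV \<times> {0, pi/2}"

definition torus_eigenvalue :: "nat \<Rightarrow> real" where
  "torus_eigenvalue n = (- 1) ^ n / (real (Suc n))\<^sup>2"

lemma sum_torus_wave_index:
  "(\<Sum>r\<in>torus_wave_index. f r) =
    f (True, 0) + f (True, pi/2) + f (False, 0) + (f (False, pi/2) :: real)"
proof -
  have "torus_wave_index = {(True, 0), (True, pi/2), (False, 0), (False, pi/2)}"
    by (auto simp: UNIV_bool)
  then show ?thesis by simp
qed

lemma torus_wave_mult:
  "torus_wave n r x * torus_wave m s y =
    2 * (circle_wave (Suc n) (snd r) (if fst r then fst x else snd x) *
         circle_wave (Suc m) (snd s) (if fst s then fst y else snd y))"
proof -
  have "sqrt 2 * p * (sqrt 2 * q) = (sqrt 2 * sqrt 2) * (p * q)" for p q :: real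
    by (simp only: mult_ac)
  then show ?thesis
    by (simp add: torus_wave_def)
qed

lemma sum_torus_wave_mult:
  "(\<Sum>r\<in>torus_wave_index. torus_wave n r (cis a, cis b) * torus_wave n r (cis (a + s), cis (b + t))) =
    2 * (cos (real (Suc n) * s) + cos (real (Suc n) * t))"
  using circle_wave_mult_sum[of "Suc n" a s] circle_wave_mult_sum[of "Suc n" b t]
  by (simp add: sum_torus_wave_index torus_wave_mult del: of_nat_Suc)

lemma integral_torus_product:
  fixes f g :: "complex \<Rightarrow> real"
  assumes [measurable]: "f \<in> borel_measurable circle_measure" "g \<in> borel_measurable circle_measure"
    and f: "\<And>z. z \<in> circle \<Longrightarrow> \<bar>f z\<bar> \<le> A" and g: "\<And>z. z \<in> circle \<Longrightarrow> \<bar>g z\<bar> \<le> B"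
  shows "(\<integral>x. f (fst x) * g (snd x) \<partial>torus_measure) =
    (\<integral>z. f z \<partial>circle_measure) * (\<integral>z. g z \<partial>circle_measure)"
proof -
  have "integrable (circle_measure \<Otimes>\<^sub>M circle_measure) (\<lambda>(x, y). f x * g y)"
  proof (rule torus.integrable_const_bound[where B = "A * B"])
    have "\<bar>f (fst x) * g (snd x)\<bar> \<le> A * B" if "x \<in> flat_torus" for x
      using that f[of "fst x"] g[of "snd x"] unfolding abs_mult
      by (intro mult_mono) (auto simp: flat_torus_def)
    then show "AE x in circle_measure \<Otimes>\<^sub>M circle_measure. norm (case x of (x, y) \<Rightarrow> f x * g y) \<le> A * B"
      using space_torus_measure by (intro AE_I2) (auto simp: torus_measure_def)
  qed measurable
  from torus.integral_fst'[OF this] show ?thesis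
    by (simp add: torus_measure_def case_prod_unfold)
qed

lemma measurable_torus_wave: "torus_wave n r \<in> borel_measurable torus_measure"
  unfolding torus_wave_def[abs_def] torus_measure_def by (cases "fst r") (simp_all, measurable)

lemma integral_torus_wave: "(\<integral>x. torus_wave n r x \<partial>torus_measure) = 0"
  using integral_torus_product[of "circle_wave (Suc n) (snd r)" "\<lambda>_. 1" 1 1]
    integral_torus_product[of "\<lambda>_. 1" "circle_wave (Suc n) (snd r)" 1 1]
  by (cases "fst r") (simp_all add: torus_wave_def integral_circle_wave abs_circle_wave_le)

lemma integral_torus_wave_mult:
  assumes "r \<in> torus_wave_index" "s \<in> torus_wave_index"
  shows "(\<integral>x. torus_wave n r x * torus_wave m s x \<partial>torus_measure) = (if n = m \<and> r = s then 1 else 0)"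
proof -
  obtain b c b' c' where rs: "r = (b, c)" "s = (b', c')" "c \<in> {0, pi/2}" "c' \<in> {0, pi/2}"
    using assms by (cases r, cases s) auto
  let ?e = "circle_wave (Suc n) c" and ?e' = "circle_wave (Suc m) c'"
  have bnd: "\<bar>?e z * ?e' z\<bar> \<le> 1" if "z \<in> circle" for z
    using mult_mono[OF abs_circle_wave_le[OF that] abs_circle_wave_le[OF that]] by (simp add: abs_mult)
  \<comment> \<open>Two phases differ by 0 or by \<open>pi/2\<close> up to sign, where the cosine is
    1 or 0. The remaining factor 1/2 is compensated by the two factors
    \<open>sqrt 2\<close>.\<close>
  have ee: "(\<integral>z. ?e z * ?e' z \<partial>circle_measure) = (if n = m \<and> c = c' then 1 / 2 else 0)"
    using rs(3,4) by (elim insertE emptyE; hypsubst) (simp_all add: integral_circle_wave_mult)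
  have fst_fst: "(\<integral>x. ?e (fst x) * ?e' (fst x) \<partial>torus_measure) = (if n = m \<and> c = c' then 1 / 2 else 0)"
    using integral_torus_product[of "\<lambda>z. ?e z * ?e' z" "\<lambda>_. 1" 1 1] bnd ee
    by (simp add: circle.prob_space[unfolded space_circle_measure])
  have snd_snd: "(\<integral>x. ?e (snd x) * ?e' (snd x) \<partial>torus_measure) = (if n = m \<and> c = c' then 1 / 2 else 0)"
    using integral_torus_product[of "\<lambda>_. 1" "\<lambda>z. ?e z * ?e' z" 1 1] bnd ee
    by (simp add: circle.prob_space[unfolded space_circle_measure])
  \<comment> \<open>Waves in different coordinates are orthogonal because the integral factors and
    each wave has mean 0.\<close>
  have fst_snd: "(\<integral>x. ?e (fst x) * ?e' (snd x) \<partial>torus_measure) = 0"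
    using integral_torus_product[of ?e ?e' 1 1] by (simp add: integral_circle_wave abs_circle_wave_le)
  have snd_fst: "(\<integral>x. ?e (snd x) * ?e' (fst x) \<partial>torus_measure) = 0"
    using integral_torus_product[of ?e' ?e 1 1]
    by (simp add: integral_circle_wave abs_circle_wave_le mult.commute)
  show ?thesis
    by (cases b; cases b')
       (simp_all add: torus_wave_mult rs(1,2) fst_fst snd_snd fst_snd snd_fst)
qed

section \<open>Cosine expansion of the kernel and its positive part\<close>

lemma sums_torus_eigenvalue_cos:
  assumes "\<bar>t\<bar> \<le> pi"
  shows "(\<lambda>n. torus_eigenvalue n * cos (real (Suc n) * t)) sums (pi\<^sup>2 / 12 - t\<^sup>2 / 4)"
proof -
  have "(\<lambda>n. - (cos (real (Suc n) * (t + pi)) / (real (Suc n))\<^sup>2)) sums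
      - (pi\<^sup>2 / 6 - pi * (t + pi) / 2 + (t + pi)\<^sup>2 / 4)"
    using assms by (intro sums_minus sums_cos_over_squares) auto
  \<comment> \<open>The shift by \<open>pi\<close> produces the alternating sign and moves
    \<open>[-pi, pi]\<close> to \<open>[0, 2 * pi]\<close>; the minus sign adjusts the exponent from
    \<open>Suc n\<close> to \<open>n\<close>.\<close>
  moreover have "cos (real m * (t + pi)) = (- 1) ^ m * cos (real m * t)" for m
    by (simp add: distrib_left cos_add cos_npi sin_npi mult.commute)
  ultimately have "(\<lambda>n. torus_eigenvalue n * cos (real (Suc n) * t)) sums
      - (pi\<^sup>2 / 6 - pi * (t + pi) / 2 + (t + pi)\<^sup>2 / 4)"
    by (simp add: torus_eigenvalue_def del: of_nat_Suc)
  also have "- (pi\<^sup>2 / 6 - pi * (t + pi) / 2 + (t + pi)\<^sup>2 / 4) = pi\<^sup>2 / 12 - t\<^sup>2 / 4"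
    by (simp add: power2_eq_square field_simps)
  finally show ?thesis .
qed

text \<open>Even \<open>n\<close> are the odd frequencies \<open>Suc n\<close>.\<close>

lemma torus_eigenvalue_pos_iff: "0 < torus_eigenvalue n \<longleftrightarrow> even n"
  by (cases "even n") (auto simp: torus_eigenvalue_def)

lemma abs_torus_eigenvalue: "\<bar>torus_eigenvalue n\<bar> = 1 / (real (Suc n))\<^sup>2"
  by (simp add: torus_eigenvalue_def power_abs)

text \<open>The positive part is half the sum of \<open>\<bar>torus_eigenvalue n\<bar>\<close> and
  \<open>torus_eigenvalue n\<close>, so two known series are averaged. Their increments from 0 are
  \<open>pi * \<bar>t\<bar> / 2 - t^2 / 4\<close> and \<open>t^2 / 4\<close>, and the squares
  cancel.\<close>

lemma sums_positive_torus_eigenvalue: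
  assumes "\<bar>t\<bar> \<le> pi"
  shows "(\<lambda>n. if 0 < torus_eigenvalue n then torus_eigenvalue n * (1 - cos (real (Suc n) * t)) else 0)
    sums (pi * \<bar>t\<bar> / 4)"
proof -
  have c: "(\<lambda>n. cos (real (Suc n) * s) / (real (Suc n))\<^sup>2) sums (pi\<^sup>2 / 6 - pi * \<bar>s\<bar> / 2 + s\<^sup>2 / 4)"
    if "\<bar>s\<bar> \<le> pi" for s
    using sums_cos_over_squares[of "\<bar>s\<bar>"] that pi_gt_zero by (cases "0 \<le> s") auto
  have "(\<lambda>n. (cos (real (Suc n) * 0) / (real (Suc n))\<^sup>2 - cos (real (Suc n) * t) / (real (Suc n))\<^sup>2
        + (torus_eigenvalue n * cos (real (Suc n) * 0) - torus_eigenvalue n * cos (real (Suc n) * t))) / 2)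
      sums ((pi\<^sup>2 / 6 - pi * \<bar>0\<bar> / 2 + 0\<^sup>2 / 4 - (pi\<^sup>2 / 6 - pi * \<bar>t\<bar> / 2 + t\<^sup>2 / 4)
        + (pi\<^sup>2 / 12 - 0\<^sup>2 / 4 - (pi\<^sup>2 / 12 - t\<^sup>2 / 4))) / 2)"
    by (intro sums_divide sums_add sums_diff c sums_torus_eigenvalue_cos assms) auto
  moreover have "(cos (real (Suc n) * 0) / (real (Suc n))\<^sup>2 - cos (real (Suc n) * t) / (real (Suc n))\<^sup>2
        + (torus_eigenvalue n * cos (real (Suc n) * 0) - torus_eigenvalue n * cos (real (Suc n) * t))) / 2
      = (if 0 < torus_eigenvalue n then torus_eigenvalue n * (1 - cos (real (Suc n) * t)) else 0)" for n
    unfolding torus_eigenvalue_pos_iff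
    by (cases "even n") (simp_all add: torus_eigenvalue_def diff_divide_distrib del: of_nat_Suc)
  moreover have "(pi\<^sup>2 / 6 - pi * \<bar>0\<bar> / 2 + 0\<^sup>2 / 4 - (pi\<^sup>2 / 6 - pi * \<bar>t\<bar> / 2 + t\<^sup>2 / 4)
        + (pi\<^sup>2 / 12 - 0\<^sup>2 / 4 - (pi\<^sup>2 / 12 - t\<^sup>2 / 4))) / 2 = pi * \<bar>t\<bar> / 4"
    by simp
  ultimately show ?thesis
    by (simp only:)
qed

text \<open>The series contributes \<open>pi^2 / 6 - s^2 / 2\<close> for a coordinate difference
  \<open>s\<close>; the constant removes the two copies of \<open>pi^2 / 6\<close>.\<close>

lemma torus_kernel_expansion:
  assumes x: "x \<in> flat_torus" and y: "y \<in> flat_torus"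
  shows "mds_kernel torus_dist x y = - (pi\<^sup>2 / 3) +
    (\<Sum>n. torus_eigenvalue n * (\<Sum>r\<in>torus_wave_index. torus_wave n r x * torus_wave n r y))"
proof -
  obtain x1 x2 y1 y2 where xy: "x = (x1, x2)" "y = (y1, y2)"
    "x1 \<in> circle" "x2 \<in> circle" "y1 \<in> circle" "y2 \<in> circle"
    using x y unfolding flat_torus_def by blast
  obtain a s where s: "x1 = cis a" "y1 = cis (a + s)" "\<bar>s\<bar> \<le> pi" "circle_dist x1 y1 = \<bar>s\<bar>"
    using circle_dist_cases xy by metis
  obtain b t where t: "x2 = cis b" "y2 = cis (b + t)" "\<bar>t\<bar> \<le> pi" "circle_dist x2 y2 = \<bar>t\<bar>"
    using circle_dist_cases xy by metis
  have "(\<Sum>r\<in>torus_wave_index. torus_wave n r x * torus_wave n r y) =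
      2 * (cos (real (Suc n) * s) + cos (real (Suc n) * t))" for n
    unfolding xy s t by (rule sum_torus_wave_mult)
  then have "(\<lambda>n. torus_eigenvalue n * (\<Sum>r\<in>torus_wave_index. torus_wave n r x * torus_wave n r y)) =
      (\<lambda>n. 2 * (torus_eigenvalue n * cos (real (Suc n) * s) + torus_eigenvalue n * cos (real (Suc n) * t)))"
    by (auto simp: algebra_simps simp del: of_nat_Suc)
  moreover have "\<dots> sums (2 * (pi\<^sup>2 / 12 - s\<^sup>2 / 4 + (pi\<^sup>2 / 12 - t\<^sup>2 / 4)))"
    by (intro sums_mult sums_add sums_torus_eigenvalue_cos s t)
  ultimately have "(\<Sum>n. torus_eigenvalue n * (\<Sum>r\<in>torus_wave_index. torus_wave n r x * torus_wave n r y))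
      = 2 * (pi\<^sup>2 / 12 - s\<^sup>2 / 4 + (pi\<^sup>2 / 12 - t\<^sup>2 / 4))"
    by (simp add: sums_iff)
  moreover have "mds_kernel torus_dist x y = - (1 / 2) * (s\<^sup>2 + t\<^sup>2)"
    using s(4) t(4) by (simp add: mds_kernel_def torus_dist_def xy(1,2))
  ultimately show ?thesis
    by (simp add: add_divide_distrib)
qed

lemma torus_expansion:
  "kernel_expansion torus_measure torus_dist (- (pi\<^sup>2 / 3)) torus_eigenvalue torus_wave torus_wave_index (sqrt 2)"
proof (intro kernel_expansion.intro prob_space_torus kernel_expansion_axioms.intro)
  show "finite torus_wave_index" by simp
  show "summable (\<lambda>n. \<bar>torus_eigenvalue n\<bar>)"
    unfolding abs_torus_eigenvalue by (rule summable_inverse_squares_Suc)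
  show "inj torus_eigenvalue"
  proof (rule injI)
    fix m n assume "torus_eigenvalue m = torus_eigenvalue n"
    then have "\<bar>torus_eigenvalue m\<bar> = \<bar>torus_eigenvalue n\<bar>" by simp
    then show "m = n"
      by (simp add: abs_torus_eigenvalue)
  qed
  show "\<bar>torus_wave n r x\<bar> \<le> sqrt 2" if "x \<in> space torus_measure" for n r x
  proof -
    have "\<bar>circle_wave (Suc n) (snd r) (if fst r then fst x else snd x)\<bar> \<le> 1"
      using that by (intro abs_circle_wave_le) (auto simp: flat_torus_def)
    then show ?thesis
      by (simp add: torus_wave_def abs_mult)
  qed
  show "mds_kernel torus_dist x y = - (pi\<^sup>2 / 3) +
      (\<Sum>n. torus_eigenvalue n * (\<Sum>r\<in>torus_wave_index. torus_wave n r x * torus_wave n r y))"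
    if "x \<in> space torus_measure" "y \<in> space torus_measure" for x y
    using that unfolding space_torus_measure by (rule torus_kernel_expansion)
qed (rule measurable_torus_wave integral_torus_wave | erule (1) integral_torus_wave_mult)+

section \<open>Continuous functions on the torus are determined by their values almost
  everywhere\<close>

lemma circle_AE_dense:
  assumes "AE x in circle_measure. Q x" "z \<in> circle" "0 < \<delta>"
  obtains x where "x \<in> circle" "Q x" "circle_dist z x < \<delta>"
proof -
  define a where "a = Arg2pi z"
  have a: "0 \<le> a" "a < 2 * pi" "z = cis a"
    using assms(2) Arg2pi_eq[of z] Arg2pi_ge_0 Arg2pi_lt_2pi by (auto simp: a_def cis_conv_exp)
  \<comment> \<open>A one-sided interval inside the parameter range: it has positive length because
    \<open>a < 2 * pi\<close>, even when \<open>z\<close> is the point with angle 0.\<close>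
  let ?I = "{a<..<min (a + \<delta>) (2 * pi)}"
  have "AE t in uniform_measure lborel {0..<2*pi}. Q (cis t)"
    using assms(1) unfolding circle_measure_def by (rule AE_distrD[OF cis_measurable])
  then have ae: "AE t in lborel. t \<in> {0..<2*pi} \<longrightarrow> Q (cis t)"
    by (subst (asm) AE_uniform_measure) auto
  have "\<exists>t\<in>?I. Q (cis t)"
  proof (rule ccontr)
    assume "\<not> ?thesis"
    then have "AE t in lborel. t \<notin> ?I"
      using ae a by (auto elim!: eventually_mono)
    then have "?I \<in> null_sets lborel"
      by (subst AE_iff_null_sets) auto
    then have "emeasure lborel ?I = 0"
      by blast
    then show False
      using a assms(3) by (simp add: min_def split: if_splits)
  qed
  then obtain t where t: "t \<in> ?I" "Q (cis t)" by blast
  have "circle_dist z (cis t) \<le> \<bar>t - a\<bar>"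
    using circle_dist_cis_le[of a "t - a"] a by simp
  with t that[of "cis t"] show ?thesis by auto
qed

lemma circle_dist_le_torus_dist:
  assumes "x \<in> flat_torus" "y \<in> flat_torus"
  shows "circle_dist (fst x) (fst y) \<le> torus_dist x y" "circle_dist (snd x) (snd y) \<le> torus_dist x y"
  unfolding torus_dist_def by (auto intro: real_le_rsqrt)

lemma torus_dist_le:
  assumes "x \<in> flat_torus" "y \<in> flat_torus"
  shows "torus_dist x y \<le> circle_dist (fst x) (fst y) + circle_dist (snd x) (snd y)"
  using assms unfolding torus_dist_def flat_torus_def
  by (intro sqrt_sum_squares_le_sum circle_dist_nonneg) auto

lemma continuous_map_torus_iff:
  fixes f :: "complex \<times> complex \<Rightarrow> real"
  shows "continuous_map (Metric_space.mtopology flat_torus torus_dist) euclideanreal f \<longleftrightarrow>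
    (\<forall>a\<in>flat_torus. \<forall>\<epsilon>>0. \<exists>\<delta>>0. \<forall>x. x \<in> flat_torus \<and> torus_dist a x < \<delta> \<longrightarrow> dist (f a) (f x) < \<epsilon>)"
  using Metric_space.metric_continuous_map[OF Metric_space_torus Met_TC.Metric_space_axioms, of f]
  by simp

lemma continuous_torus_wave:
  "continuous_map (Metric_space.mtopology flat_torus torus_dist) euclideanreal (torus_wave n r)"
  unfolding continuous_map_torus_iff
proof (intro ballI allI impI)
  fix x :: "complex \<times> complex" and \<epsilon> :: real assume x: "x \<in> flat_torus" and \<epsilon>: "0 < \<epsilon>"
  define K where "K = sqrt 2 * real (Suc n)"
  have K: "0 < K" by (simp add: K_def)
  have lip: "dist (torus_wave n r x) (torus_wave n r y) \<le> K * torus_dist x y" if y: "y \<in> flat_torus" for y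
  proof -
    let ?p = "\<lambda>z. if fst r then fst z else snd z :: complex"
    have "dist (?p x) (?p y) \<le> torus_dist x y"
      using x y dist_le_circle_dist[of "?p x" "?p y"] circle_dist_le_torus_dist[OF x y]
      by (auto simp: flat_torus_def)
    then have "real (Suc n) * dist (?p x) (?p y) \<le> real (Suc n) * torus_dist x y"
      by (rule mult_left_mono) simp
    moreover have "\<bar>circle_wave (Suc n) (snd r) (?p x) - circle_wave (Suc n) (snd r) (?p y)\<bar> \<le>
        real (Suc n) * dist (?p x) (?p y)"
      using x y by (intro circle_wave_lipschitz) (auto simp: flat_torus_def)
    ultimately have "sqrt 2 * \<bar>circle_wave (Suc n) (snd r) (?p x) - circle_wave (Suc n) (snd r) (?p y)\<bar>
        \<le> sqrt 2 * (real (Suc n) * torus_dist x y)"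
      by (intro mult_left_mono) (rule order_trans, assumption+, simp)
    then show ?thesis
      by (simp add: torus_wave_def dist_real_def right_diff_distrib[symmetric] abs_mult K_def mult.assoc
          del: of_nat_Suc)
  qed
  have "dist (torus_wave n r x) (torus_wave n r y) < \<epsilon>" if "y \<in> flat_torus" "torus_dist x y < \<epsilon> / K" for y
    using lip[OF that(1)] that(2) K by (simp add: field_simps)
  then show "\<exists>\<delta>>0. \<forall>y. y \<in> flat_torus \<and> torus_dist x y < \<delta> \<longrightarrow>
      dist (torus_wave n r x) (torus_wave n r y) < \<epsilon>"
    using \<epsilon> K by (intro exI[of _ "\<epsilon> / K"]) auto
qed

lemma continuous_torus_AE_eq:
  fixes f g :: "complex \<times> complex \<Rightarrow> real"
  assumes f: "continuous_map (Metric_space.mtopology flat_torus torus_dist) euclideanreal f"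
    and g: "continuous_map (Metric_space.mtopology flat_torus torus_dist) euclideanreal g"
    and ae: "AE x in torus_measure. f x = g x" and z: "z \<in> flat_torus"
  shows "f z = g z"
proof (rule ccontr)
  assume "f z \<noteq> g z"
  then have \<epsilon>: "0 < dist (f z) (g z) / 2" by simp
  obtain \<delta>1 where \<delta>1: "0 < \<delta>1"
    "\<And>x. x \<in> flat_torus \<Longrightarrow> torus_dist z x < \<delta>1 \<Longrightarrow> dist (f z) (f x) < dist (f z) (g z) / 2"
    using f z \<epsilon> unfolding continuous_map_torus_iff by meson
  obtain \<delta>2 where \<delta>2: "0 < \<delta>2"
    "\<And>x. x \<in> flat_torus \<Longrightarrow> torus_dist z x < \<delta>2 \<Longrightarrow> dist (g z) (g x) < dist (f z) (g z) / 2"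
    using g z \<epsilon> unfolding continuous_map_torus_iff by meson
  \<comment> \<open>The factor 1/2 is there because the torus distance is bounded by the sum of two
    coordinate distances, each below \<open>\<delta>\<close>.\<close>
  define \<delta> where "\<delta> = min \<delta>1 \<delta>2 / 2"
  have \<delta>: "0 < \<delta>" using \<delta>1 \<delta>2 by (simp add: \<delta>_def)
  \<comment> \<open>The good point is found one coordinate at a time: first \<open>x1\<close> near
    \<open>fst z\<close> with a slice that is good almost everywhere, then \<open>x2\<close> in that
    slice.\<close>
  have "AE x1 in circle_measure. AE x2 in circle_measure. f (x1, x2) = g (x1, x2)"
    using ae unfolding torus_measure_def by (rule torus.AE_pair)
  note ae1 = this
  have z12: "fst z \<in> circle" "snd z \<in> circle"
    using z by (auto simp: flat_torus_def)
  obtain x1 where x1: "x1 \<in> circle" "AE x2 in circle_measure. f (x1, x2) = g (x1, x2)"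
    "circle_dist (fst z) x1 < \<delta>"
    by (rule circle_AE_dense[OF ae1 z12(1) \<delta>])
  obtain x2 where x2: "x2 \<in> circle" "f (x1, x2) = g (x1, x2)" "circle_dist (snd z) x2 < \<delta>"
    by (rule circle_AE_dense[OF x1(2) z12(2) \<delta>])
  have w: "(x1, x2) \<in> flat_torus"
    using x1 x2 by (simp add: flat_torus_def)
  have "torus_dist z (x1, x2) < 2 * \<delta>"
    using torus_dist_le[OF z w] x1 x2 by simp
  then have "dist (f z) (f (x1, x2)) < dist (f z) (g z) / 2" "dist (g z) (g (x1, x2)) < dist (f z) (g z) / 2"
    using \<delta>1(2)[OF w] \<delta>2(2)[OF w] by (auto simp: \<delta>_def)
  then show False
    using dist_triangle2[of "f z" "g z" "f (x1, x2)"] x2(2) by simp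
qed

section \<open>Squared distances of the MDS map and the Hoelder bounds\<close>

lemma mds_map_torus:
  assumes "infinite_mds_map torus_measure torus_dist M"
    and x: "x \<in> flat_torus" and y: "y \<in> flat_torus"
  shows "summable (\<lambda>j. (M x j)\<^sup>2)"
    and "(\<lambda>j. (M x j - M y j)\<^sup>2) sums
      (pi * (circle_dist (fst x) (fst y) + circle_dist (snd x) (snd y)))"
proof -
  interpret kernel_expansion torus_measure torus_dist "- (pi\<^sup>2 / 3)" torus_eigenvalue torus_wave
      torus_wave_index "sqrt 2"
    by (rule torus_expansion)
  obtain N lam u where sys: "positive_eigensystem torus_measure torus_dist N lam u"
    and M: "M = (\<lambda>x j. if enat j < N then sqrt (lam j) * u j x else 0)"
    using assms(1) unfolding infinite_mds_map_def by blast
  have lam: "0 < lam j" if "enat j < N" for j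
    using sys that by (simp add: positive_eigensystem_def)
  have M_sums: "(\<lambda>j. (a * M x j + b * M y j)\<^sup>2) sums S"
    if "(\<lambda>n. if 0 < torus_eigenvalue n then torus_eigenvalue n *
      (\<Sum>r\<in>torus_wave_index. (a * torus_wave n r x + b * torus_wave n r y)\<^sup>2) else 0) sums S" for a b S
  proof -
    have "(a * M x j + b * M y j)\<^sup>2 = (if enat j < N then lam j * (a * u j x + b * u j y)\<^sup>2 else 0)" for j
    proof (cases "enat j < N")
      case True
      have "(a * M x j + b * M y j)\<^sup>2 = (sqrt (lam j) * (a * u j x + b * u j y))\<^sup>2"
        using True by (simp add: M algebra_simps)
      then show ?thesis
        using True lam[OF True] by (simp add: power_mult_distrib)
    qed (simp add: M)
    moreover have "(\<lambda>j. if enat j < N then lam j * (a * u j x + b * u j y)\<^sup>2 else 0) sums S"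
    proof (rule positive_eigensystem_sums[OF sys _ _ _ _ that], unfold space_torus_measure)
      show "f z = g z"
        if "continuous_map (Metric_space.mtopology flat_torus torus_dist) euclideanreal f"
          "continuous_map (Metric_space.mtopology flat_torus torus_dist) euclideanreal g"
          "AE w in torus_measure. f w = g w" "z \<in> flat_torus" for f g z
        using that by (rule continuous_torus_AE_eq)
    qed (rule continuous_torus_wave x y)+
    ultimately show ?thesis
      by (simp only:)
  qed
  obtain x1 x2 y1 y2 where xy: "x = (x1, x2)" "y = (y1, y2)"
    "x1 \<in> circle" "x2 \<in> circle" "y1 \<in> circle" "y2 \<in> circle"
    using x y unfolding flat_torus_def by blast
  obtain a s where s: "x1 = cis a" "y1 = cis (a + s)" "\<bar>s\<bar> \<le> pi" "circle_dist x1 y1 = \<bar>s\<bar>"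
    using circle_dist_cases xy by metis
  obtain b t where t: "x2 = cis b" "y2 = cis (b + t)" "\<bar>t\<bar> \<le> pi" "circle_dist x2 y2 = \<bar>t\<bar>"
    using circle_dist_cases xy by metis
  \<comment> \<open>Angle differences 0 in both coordinates give \<open>2 * (1 + 1)\<close>; so the
    squared norm of \<open>M x\<close> is 4 times the sum of the positive
    \<open>torus_eigenvalue n\<close>.\<close>
  have norm_eq: "(\<Sum>r\<in>torus_wave_index. (1 * torus_wave n r x + 0 * torus_wave n r y)\<^sup>2) = 4" for n
    using sum_torus_wave_mult[of n a b 0 0] by (simp add: xy s(1) t(1) power2_eq_square)
  have "summable (\<lambda>n. if 0 < torus_eigenvalue n then torus_eigenvalue n *
      (\<Sum>r\<in>torus_wave_index. (1 * torus_wave n r x + 0 * torus_wave n r y)\<^sup>2) else 0)"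
    unfolding norm_eq
    by (rule summable_comparison_test'[OF summable_mult2[OF summable_\<kappa>, of 4], of 0]) auto
  from M_sums[OF summable_sums[OF this]] show "summable (\<lambda>j. (M x j)\<^sup>2)"
    by (simp add: sums_iff)
  \<comment> \<open>Polarization: both square sums are 4, and the mixed sum is given by the
    differences \<open>s\<close> and \<open>t\<close>.\<close>
  have diff_eq: "(\<Sum>r\<in>torus_wave_index. (1 * torus_wave n r x + (- 1) * torus_wave n r y)\<^sup>2) =
      4 * ((1 - cos (real (Suc n) * s)) + (1 - cos (real (Suc n) * t)))" for n
  proof -
    have "(\<Sum>r\<in>A. (1 * f r + (- 1) * g r)\<^sup>2) =
        (\<Sum>r\<in>A. f r * f r) - 2 * (\<Sum>r\<in>A. f r * g r) + (\<Sum>r\<in>A. g r * g r)"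
      for f g :: "bool \<times> real \<Rightarrow> real" and A
      by (simp add: power2_eq_square algebra_simps sum.distrib sum_subtractf sum_distrib_left)
    then show ?thesis
      using sum_torus_wave_mult[of n a b s t] sum_torus_wave_mult[of n a b 0 0]
        sum_torus_wave_mult[of n "a + s" "b + t" 0 0]
      by (simp add: xy s(1,2) t(1,2) del: of_nat_Suc)
  qed
  have "(\<lambda>n. 4 * ((if 0 < torus_eigenvalue n then torus_eigenvalue n * (1 - cos (real (Suc n) * s)) else 0) +
      (if 0 < torus_eigenvalue n then torus_eigenvalue n * (1 - cos (real (Suc n) * t)) else 0)))
      sums (4 * (pi * \<bar>s\<bar> / 4 + pi * \<bar>t\<bar> / 4))"
    by (intro sums_mult sums_add sums_positive_torus_eigenvalue s t)
  then have "(\<lambda>n. if 0 < torus_eigenvalue n then torus_eigenvalue n *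
      (\<Sum>r\<in>torus_wave_index. (1 * torus_wave n r x + (- 1) * torus_wave n r y)\<^sup>2) else 0) sums
      (4 * (pi * \<bar>s\<bar> / 4 + pi * \<bar>t\<bar> / 4))"
    unfolding diff_eq
    by (rule back_subst[where P = "\<lambda>f. f sums _"]) (auto intro!: ext simp: algebra_simps simp del: of_nat_Suc)
  from M_sums[OF this] show "(\<lambda>j. (M x j - M y j)\<^sup>2) sums
      (pi * (circle_dist (fst x) (fst y) + circle_dist (snd x) (snd y)))"
    using s(4) t(4) by (simp add: xy(1,2) distrib_left)
qed

theorem proposition6p3:
  fixes M :: "complex \<times> complex \<Rightarrow> nat \<Rightarrow> real"
  assumes "infinite_mds_map torus_measure torus_dist M"
  shows "M ` flat_torus \<subseteq> ell2 \<and>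
    (\<forall>x1\<in>circle. \<forall>x2\<in>circle. \<forall>y1\<in>circle. \<forall>y2\<in>circle.
       (ell2_norm (\<lambda>j. M (x1, x2) j - M (y1, y2) j))\<^sup>2
         = pi * (circle_dist x1 y1 + circle_dist x2 y2)) \<and>
    bi_hoelder_on flat_torus torus_dist ell2_dist M"
proof (intro conjI)
  show "M ` flat_torus \<subseteq> ell2"
    using mds_map_torus(1)[OF assms] by (auto simp: ell2_def)
  have norm_sq: "(ell2_norm (\<lambda>j. M x j - M y j))\<^sup>2 =
      pi * (circle_dist (fst x) (fst y) + circle_dist (snd x) (snd y))"
    if "x \<in> flat_torus" "y \<in> flat_torus" for x y
  proof -
    have "summable (\<lambda>j. (M x j - M y j)\<^sup>2)"
      and sum: "(\<Sum>j. (M x j - M y j)\<^sup>2) = pi * (circle_dist (fst x) (fst y) + circle_dist (snd x) (snd y))"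
      using mds_map_torus(2)[OF assms that] by (simp_all add: sums_iff)
    then have "0 \<le> (\<Sum>j. (M x j - M y j)\<^sup>2)"
      by (intro suminf_nonneg) auto
    then show ?thesis
      unfolding ell2_norm_def by (simp only: real_sqrt_pow2 sum)
  qed
  then show "\<forall>x1\<in>circle. \<forall>x2\<in>circle. \<forall>y1\<in>circle. \<forall>y2\<in>circle.
      (ell2_norm (\<lambda>j. M (x1, x2) j - M (y1, y2) j))\<^sup>2 = pi * (circle_dist x1 y1 + circle_dist x2 y2)"
    by (simp add: flat_torus_def)
  \<comment> \<open>The sum of the coordinate distances lies between \<open>d\<close> and
    \<open>2 * d\<close>, so \<open>D^2\<close> lies between \<open>pi * d\<close> and
    \<open>2 * pi * d\<close>. The upper bound gives exponent 1/2, with constant 3 from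
    \<open>2 * pi < 8 \<le> 3^2\<close>.\<close>
  have "ell2_dist (M x) (M y) \<le> 3 * torus_dist x y powr (1/2) \<and>
      torus_dist x y \<le> 3 * ell2_dist (M x) (M y) powr 1"
    if x: "x \<in> flat_torus" and y: "y \<in> flat_torus" for x y
  proof -
    let ?d1 = "circle_dist (fst x) (fst y)" and ?d2 = "circle_dist (snd x) (snd y)"
    define d D where "d = torus_dist x y" and "D = ell2_dist (M x) (M y)"
    have D2: "D\<^sup>2 = pi * (?d1 + ?d2)"
      using norm_sq[OF x y] by (simp add: D_def ell2_dist_def)
    have D0: "0 \<le> D"
      unfolding D_def ell2_dist_def ell2_norm_def
      by (intro real_sqrt_ge_zero suminf_nonneg sums_summable[OF mds_map_torus(2)[OF assms x y]]) simp
    have d: "?d1 \<le> d" "?d2 \<le> d" "d \<le> ?d1 + ?d2" "0 \<le> d"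
      using circle_dist_le_torus_dist[OF x y] torus_dist_le[OF x y]
      by (auto simp: d_def torus_dist_def)
    have pi: "?d1 \<le> pi" "?d2 \<le> pi"
      using x y by (auto simp: flat_torus_def circle_dist_le_pi)
    have "D \<le> 3 * sqrt d"
    proof (rule power2_le_imp_le)
      have "D\<^sup>2 \<le> pi * (2 * d)"
        unfolding D2 using d by (intro mult_left_mono) auto
      also have "\<dots> \<le> 4 * (2 * d)"
        using d pi_less_4 by (intro mult_right_mono) auto
      also have "\<dots> \<le> (3 * sqrt d)\<^sup>2"
        using d by (simp add: power_mult_distrib)
      finally show "D\<^sup>2 \<le> (3 * sqrt d)\<^sup>2" .
    qed (use d in simp)
    \<comment> \<open>The lower bound \<open>pi * d \<le> D^2\<close> has exponent 2, but
      \<open>bi_hoelder_on\<close> admits at most 1. The image is bounded,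
      \<open>D \<le> 2 * pi\<close>, so one factor \<open>D\<close> is traded for a
      constant.\<close>
    moreover have "d \<le> 3 * D"
    proof -
      have "D \<le> 2 * pi"
      proof (rule power2_le_imp_le)
        have "D\<^sup>2 \<le> pi * (pi + pi)"
          unfolding D2 using pi by (intro mult_left_mono) auto
        also have "\<dots> \<le> (2 * pi)\<^sup>2"
          by (simp add: power2_eq_square)
        finally show "D\<^sup>2 \<le> (2 * pi)\<^sup>2" .
      qed simp
      have "pi * d \<le> D * D"
        using d D2 by (simp add: power2_eq_square)
      also have "\<dots> \<le> 2 * pi * D"
        using \<open>D \<le> 2 * pi\<close> D0 by (rule mult_right_mono)
      finally have "d \<le> 2 * D"
        using mult_le_cancel_left_pos[OF pi_gt_zero, of d "2 * D"] by (simp add: mult.left_commute)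
      then show ?thesis using D0 by simp
    qed
    ultimately show ?thesis
      using d D0 by (simp add: d_def D_def powr_half_sqrt)
  qed
  then show "bi_hoelder_on flat_torus torus_dist ell2_dist M"
    unfolding bi_hoelder_on_def
    by (intro exI[of _ "3 :: real"] exI[of _ "1/2 :: real"] exI[of _ "1 :: real"] conjI ballI) auto
qed

end
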